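(* Let $k$ be a field, $\mathfrak{g}$ a nonzero Lie algebra over $k$ that is a subspace of codimension $1$ in the vector space $E$, and $V$ a complement of $\mathfrak{g}$ in $E$, with basis $\{x\}$. Then: (1) $\equiv$ is an equivalence relation on the set $\mathrm{TwDer}(\mathfrak{g})$ of all twisted derivations of $\mathfrak{g}$. (2) $\mathrm{Extd}(E, \mathfrak{g}) \cong \mathcal{H}^{2}_{\mathfrak{g}}(V, \mathfrak{g}) \cong \mathrm{TwDer}(\mathfrak{g})/\equiv$ (bijections of sets). The bijection between $\mathrm{TwDer}(\mathfrak{g})/\equiv$ and $\mathrm{Extd}(E, \mathfrak{g})$ is given by $$\overline{(\lambda, D)} \mapsto \mathfrak{g} \,\natural\,_{(\lambda, D)} V,$$ where $\overline{(\lambda, D)}$ is the equivalence class of $(\lambda, D)$ via $\equiv$. (3) $\mathcal{H}^{2}(V, \mathfrak{g}) \cong \mathrm{TwDer}(\mathfrak{g})/\approx$ (bijection of sets, induced by sending $(\lambda,D)$ to the Lie extending structure $\Omega_{(\lambda,D)}$), where $\approx$ is the following relation: $(\lambda, D) \approx (\lambda', D')$ if and only if $\lambda = \lambda'$ and $D - D'$ is an inner twisted derivation of $\mathfrak{g}$, i.e. there is $g_0\in\mathfrak{g}$ with $(D-D')(h)=[g_0,h]-\lambda(h)g_0$ for all $h\in\mathfrak{g}$.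
   Context: All vector spaces, Lie algebras, linear and bilinear maps are over an arbitrary field $k$; $k^*=k\setminus\{0\}$. A complement of $\mathfrak{g}$ in $E$ is a subspace $V$ with $E=\mathfrak{g}+V$, $V\cap\mathfrak{g}=0$; its dimension is the codimension of $\mathfrak{g}$ in $E$. Twisted derivations. A twisted derivation of $\mathfrak{g}$ is a pair $(\lambda,D)$ of linear maps $\lambda:\mathfrak{g}\to k$, $D:\mathfrak{g}\to\mathfrak{g}$ such that for all $g,h\in\mathfrak{g}$: $\lambda([g,h])=0$ and $D([g,h])=[D(g),h]+[g,D(h)]+\lambda(g)D(h)-\lambda(h)D(g)$. $\mathrm{TwDer}(\mathfrak{g})$ is the set of all of them. Write $(\lambda,D)\equiv(\lambda',D')$ if $\lambda=\lambda'$ and there is $(g_0,q)\in\mathfrak{g}\times k^*$ with $D(h)=qD'(h)+[g_0,h]-\lambda(h)g_0$ for all $h\in\mathfrak{g}$. Unified products. An extending datum of $\mathfrak{g}$ through $V$ is a system $(\triangleleft, \triangleright, f, \{-,-\})$ of four bilinear maps $\triangleleft : V \times \mathfrak{g} \to V$, $\triangleright : V \times \mathfrak{g} \to \mathfrak{g}$, $f : V\times V \to \mathfrak{g}$, $\{-,-\} : V\times V \to V$. It is a Lie extending structure if $\mathfrak{g}\times V$ is a Lie algebra (denoted $\mathfrak{g}\,\natural\, V$, the unified product) with the bracket $$[(g, x), (h, y)] := \bigl([g, h] + x \triangleright h - y\triangleright g + f(x, y),\ \{x, y\} + x\triangleleft h - y\triangleleft g\bigr).$$ $\mathcal{L}(\mathfrak{g},V)$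 is the set of Lie extending structures. For $(\lambda,D)\in\mathrm{TwDer}(\mathfrak{g})$, $\Omega_{(\lambda,D)}$ is the Lie extending structure $x\triangleleft g=\lambda(g)x$, $x\triangleright g=D(g)$, $f=0$, $\{-,-\}=0$ ($x$ the basis vector of $V$), and $\mathfrak{g}\,\natural\,_{(\lambda,D)}V$ is its unified product, with bracket determined by $[(g,0),(h,0)]=([g,h],0)$, $[(g,0),(0,x)]=-(D(g),\lambda(g)x)$. The object $\mathcal{H}^2_{\mathfrak{g}}(V,\mathfrak{g})$ is the quotient of $\mathcal{L}(\mathfrak{g},V)$ by the equivalence relation: $(\triangleleft, \triangleright, f, \{-,-\})\equiv(\triangleleft', \triangleright', f', \{-,-\}')$ if there exist a linear map $r: V\to\mathfrak{g}$ and $v\in\mathrm{Aut}_k(V)$ such that for all $g\in\mathfrak{g}$, $x,y\in V$: \begin{align*} x \triangleleft' g &= v\bigl(v^{-1}(x) \triangleleft g\bigr),\\ x \triangleright' g &= r\bigl(v^{-1}(x) \triangleleft g\bigr) + v^{-1}(x) \triangleright g + [g, r(v^{-1}(x))],\\ f'(x, y) &= f\bigl(v^{-1}(x), v^{-1}(y)\bigr) + r\bigl(\{v^{-1}(x), v^{-1}(y)\}\bigr) + [r(v^{-1}(x)), r(v^{-1}(y))]\\ &\quad - r\bigl(v^{-1}(x) \triangleleft r(v^{-1}(y))\bigr) - v^{-1}(x) \triangleright r(v^{-1}(y))\\ &\quad + r\bigl(v^{-1}(y) \triangleleft r(v^{-1}(x))\bigr) + v^{-1}(y) \triangleright r(v^{-1}(x)),\\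 \{x, y\}' &= v\bigl(\{v^{-1}(x), v^{-1}(y)\}\bigr) - v\bigl(v^{-1}(x) \triangleleft r(v^{-1}(y))\bigr) + v\bigl(v^{-1}(y) \triangleleft r(v^{-1}(x))\bigr). \end{align*} The object $\mathcal{H}^2(V,\mathfrak{g})$ is the quotient of $\mathcal{L}(\mathfrak{g},V)$ by the finer equivalence relation in which $(\triangleleft, \triangleright, f, \{-,-\})$ and $(\triangleleft', \triangleright', f', \{-,-\}')$ are related if there exists a linear map $r:V\to\mathfrak{g}$ such that for all $g\in\mathfrak{g}$, $x,y\in V$: \begin{align*} x \triangleleft' g &= x \triangleleft g,\\ x \triangleright' g &= r(x \triangleleft g) + x \triangleright g + [g, r(x)],\\ f'(x, y) &= f(x, y) + r(\{x, y\}) + [r(x), r(y)] - r\bigl(x \triangleleft r(y)\bigr) - x \triangleright r(y) + r\bigl(y \triangleleft r(x)\bigr) + y \triangleright r(x),\\ \{x, y\}' &= \{x, y\} - x \triangleleft r(y) + y \triangleleft r(x). \end{align*} $\mathrm{Extd}(E,\mathfrak{g})$ is the set of equivalence classes of Lie algebra structures on $E$ containing $\mathfrak{g}$ as a Lie subalgebra, two such being equivalent if there is a Lie algebra isomorphism $\varphi$ between them with $\varphi(g)=g$ for all $g\in\mathfrak{g}$. A unified product $\mathfrak{g}\,\natural\, V$ is regarded as a Lie algebra structure on $E$ via the linear isomorphism $\mathfrak{g}\times V\to E$, $(g,x)\mapsto g+x$. *)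

theory Defs
  imports "HOL-Analysis.Product_Vector" "HOL-Library.FuncSet"
begin

text \<open>
  The field is a type \<open>'k\<close> of class field, and the ambient space \<open>E\<close> is a type \<open>'e\<close> that
  the scalar multiplication \<open>s\<close> makes into a vector space over \<open>'k\<close>.  The Lie algebra
  \<open>G\<close> (with bracket \<open>br\<close>) and its complement \<open>V\<close> are subspaces of \<open>E\<close>, given as sets;
  only the values of \<open>br\<close> on \<open>G\<close> matter.  Maps defined on a subspace are extensional
  functions (\<open>PiE\<close>), so that two of them are equal in HOL iff they agree on the subspace.
\<close>

subsection \<open>Linear algebra and Lie algebras on subspaces\<close>

definition linear_on ::
  "('k \<Rightarrow> 'a::plus \<Rightarrow> 'a) \<Rightarrow> ('k \<Rightarrow> 'b::plus \<Rightarrow> 'b) \<Rightarrow> 'a set \<Rightarrow> ('a \<Rightarrow> 'b) \<Rightarrow> bool" where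
  "linear_on s1 s2 A f \<longleftrightarrow>
     (\<forall>x\<in>A. \<forall>y\<in>A. f (x + y) = f x + f y) \<and> (\<forall>c. \<forall>x\<in>A. f (s1 c x) = s2 c (f x))"

definition bilinear_on ::
  "('k \<Rightarrow> 'a::plus \<Rightarrow> 'a) \<Rightarrow> ('k \<Rightarrow> 'b::plus \<Rightarrow> 'b) \<Rightarrow> ('k \<Rightarrow> 'c::plus \<Rightarrow> 'c) \<Rightarrow>
     'a set \<Rightarrow> 'b set \<Rightarrow> ('a \<Rightarrow> 'b \<Rightarrow> 'c) \<Rightarrow> bool" where
  "bilinear_on s1 s2 s3 A B f \<longleftrightarrow>
     (\<forall>a\<in>A. linear_on s2 s3 B (f a)) \<and> (\<forall>b\<in>B. linear_on s1 s3 A (\<lambda>a. f a b))"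

definition lie_algebra_on ::
  "('k::field \<Rightarrow> 'a::ab_group_add \<Rightarrow> 'a) \<Rightarrow> 'a set \<Rightarrow> ('a \<Rightarrow> 'a \<Rightarrow> 'a) \<Rightarrow> bool" where
  "lie_algebra_on s L b \<longleftrightarrow>
     module.subspace s L \<and> b \<in> L \<rightarrow> L \<rightarrow> L \<and> bilinear_on s s s L L b \<and>
     (\<forall>x\<in>L. b x x = 0) \<and>
     (\<forall>x\<in>L. \<forall>y\<in>L. \<forall>z\<in>L. b x (b y z) + b y (b z x) + b z (b x y) = 0)"

definition complement_of ::
  "('k::field \<Rightarrow> 'e::ab_group_add \<Rightarrow> 'e) \<Rightarrow> 'e set \<Rightarrow> 'e set \<Rightarrow> bool" where
  "complement_of s G V \<longleftrightarrow>
     module.subspace s V \<and> {a + u | a u. a \<in> G \<and> u \<in> V} = UNIV \<and> V \<inter> G = {0}"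

subsection \<open>Twisted derivations\<close>

definition TwDer ::
  "('k::field \<Rightarrow> 'e::ab_group_add \<Rightarrow> 'e) \<Rightarrow> 'e set \<Rightarrow> ('e \<Rightarrow> 'e \<Rightarrow> 'e) \<Rightarrow>
     (('e \<Rightarrow> 'k) \<times> ('e \<Rightarrow> 'e)) set" where
  "TwDer s G br = {(l, D).
     l \<in> G \<rightarrow>\<^sub>E UNIV \<and> linear_on s (*) G l \<and>
     D \<in> G \<rightarrow>\<^sub>E G \<and> linear_on s s G D \<and>
     (\<forall>g\<in>G. \<forall>h\<in>G. l (br g h) = 0) \<and>
     (\<forall>g\<in>G. \<forall>h\<in>G. D (br g h) = br (D g) h + br g (D h) + s (l g) (D h) - s (l h) (D g))}"

definition TwDer_equiv ::
  "('k::field \<Rightarrow> 'e::ab_group_add \<Rightarrow> 'e) \<Rightarrow> 'e set \<Rightarrow> ('e \<Rightarrow> 'e \<Rightarrow> 'e) \<Rightarrow>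
     ((('e \<Rightarrow> 'k) \<times> ('e \<Rightarrow> 'e)) \<times> (('e \<Rightarrow> 'k) \<times> ('e \<Rightarrow> 'e))) set" where
  "TwDer_equiv s G br = {((l, D), (l', D')).
     (l, D) \<in> TwDer s G br \<and> (l', D') \<in> TwDer s G br \<and> l = l' \<and>
     (\<exists>g0\<in>G. \<exists>q. q \<noteq> 0 \<and> (\<forall>h\<in>G. D h = s q (D' h) + br g0 h - s (l h) g0))}"

definition TwDer_approx ::
  "('k::field \<Rightarrow> 'e::ab_group_add \<Rightarrow> 'e) \<Rightarrow> 'e set \<Rightarrow> ('e \<Rightarrow> 'e \<Rightarrow> 'e) \<Rightarrow>
     ((('e \<Rightarrow> 'k) \<times> ('e \<Rightarrow> 'e)) \<times> (('e \<Rightarrow> 'k) \<times> ('e \<Rightarrow> 'e))) set" where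
  "TwDer_approx s G br = {((l, D), (l', D')).
     (l, D) \<in> TwDer s G br \<and> (l', D') \<in> TwDer s G br \<and> l = l' \<and>
     (\<exists>g0\<in>G. \<forall>h\<in>G. D h - D' h = br g0 h - s (l h) g0)}"

subsection \<open>Unified products\<close>

text \<open>
  An extending datum is a tuple \<open>(ra, la, f, cu)\<close>, where \<open>ra x g\<close> is the right action
  \<open>x \<triangleleft> g\<close> with values in \<open>V\<close>, \<open>la x g\<close> is the left action \<open>x \<triangleright> g\<close> with values in \<open>G\<close>,
  and \<open>cu x y\<close> is \<open>{x, y}\<close>.
\<close>

type_synonym 'e ext_datum =
  "('e \<Rightarrow> 'e \<Rightarrow> 'e) \<times> ('e \<Rightarrow> 'e \<Rightarrow> 'e) \<times> ('e \<Rightarrow> 'e \<Rightarrow> 'e) \<times> ('e \<Rightarrow> 'e \<Rightarrow> 'e)"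

definition extending_data ::
  "('k::field \<Rightarrow> 'e::ab_group_add \<Rightarrow> 'e) \<Rightarrow> 'e set \<Rightarrow> 'e set \<Rightarrow> 'e ext_datum set" where
  "extending_data s G V = {(ra, la, f, cu).
     ra \<in> V \<rightarrow>\<^sub>E G \<rightarrow>\<^sub>E V \<and> bilinear_on s s s V G ra \<and>
     la \<in> V \<rightarrow>\<^sub>E G \<rightarrow>\<^sub>E G \<and> bilinear_on s s s V G la \<and>
     f \<in> V \<rightarrow>\<^sub>E V \<rightarrow>\<^sub>E G \<and> bilinear_on s s s V V f \<and>
     cu \<in> V \<rightarrow>\<^sub>E V \<rightarrow>\<^sub>E V \<and> bilinear_on s s s V V cu}"

fun unified_bracket ::
  "('e::ab_group_add \<Rightarrow> 'e \<Rightarrow> 'e) \<Rightarrow> 'e ext_datum \<Rightarrow> 'e \<times> 'e \<Rightarrow> 'e \<times> 'e \<Rightarrow> 'e \<times> 'e" where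
  "unified_bracket br (ra, la, f, cu) (g, x) (h, y) =
     (br g h + la x h - la y g + f x y, cu x y + ra x h - ra y g)"

definition lie_ext_structures ::
  "('k::field \<Rightarrow> 'e::ab_group_add \<Rightarrow> 'e) \<Rightarrow> 'e set \<Rightarrow> ('e \<Rightarrow> 'e \<Rightarrow> 'e) \<Rightarrow> 'e set \<Rightarrow>
     'e ext_datum set" where
  "lie_ext_structures s G br V = {\<Omega> \<in> extending_data s G V.
     lie_algebra_on (module_prod.scale s s) (G \<times> V) (unified_bracket br \<Omega>)}"

text \<open>The unified product as a bracket on \<open>E\<close>, transported along \<open>(g, x) \<mapsto> g + x\<close>.\<close>

definition unified_structure ::
  "'e::ab_group_add set \<Rightarrow> ('e \<Rightarrow> 'e \<Rightarrow> 'e) \<Rightarrow> 'e set \<Rightarrow> 'e ext_datum \<Rightarrow> 'e \<Rightarrow> 'e \<Rightarrow> 'e" where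
  "unified_structure G br V \<Omega> a b =
     (let \<phi> = (\<lambda>(g, x). g + x); \<psi> = the_inv_into (G \<times> V) \<phi>
      in \<phi> (unified_bracket br \<Omega> (\<psi> a) (\<psi> b)))"

text \<open>
  \<open>\<Omega>\<close> of a twisted derivation with respect to the basis vector \<open>x\<close> of \<open>V\<close>.  The
  prescriptions \<open>x \<triangleleft> g = l g x\<close> and \<open>x \<triangleright> g = D g\<close> are extended linearly to all of \<open>V\<close>:
  a vector \<open>u\<close> of \<open>V\<close> is its \<open>x\<close>-coordinate times \<open>x\<close>.
\<close>

definition Omega ::
  "('k::field \<Rightarrow> 'e::ab_group_add \<Rightarrow> 'e) \<Rightarrow> 'e set \<Rightarrow> 'e set \<Rightarrow> 'e \<Rightarrow>
     ('e \<Rightarrow> 'k) \<times> ('e \<Rightarrow> 'e) \<Rightarrow> 'e ext_datum" where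
  "Omega s G V x = (\<lambda>(l, D).
     (\<lambda>u\<in>V. \<lambda>g\<in>G. s (module.representation s {x} u x) (s (l g) x),
      \<lambda>u\<in>V. \<lambda>g\<in>G. s (module.representation s {x} u x) (D g),
      \<lambda>u\<in>V. \<lambda>w\<in>V. 0,
      \<lambda>u\<in>V. \<lambda>w\<in>V. 0))"

subsection \<open>The classifying objects\<close>

definition H2g_equiv ::
  "('k::field \<Rightarrow> 'e::ab_group_add \<Rightarrow> 'e) \<Rightarrow> 'e set \<Rightarrow> ('e \<Rightarrow> 'e \<Rightarrow> 'e) \<Rightarrow> 'e set \<Rightarrow>
     ('e ext_datum \<times> 'e ext_datum) set" where
  "H2g_equiv s G br V = {((ra, la, f, cu), (ra', la', f', cu')).
     (ra, la, f, cu) \<in> lie_ext_structures s G br V \<and>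
     (ra', la', f', cu') \<in> lie_ext_structures s G br V \<and>
     (\<exists>r v. r \<in> V \<rightarrow> G \<and> linear_on s s V r \<and> bij_betw v V V \<and> linear_on s s V v \<and>
       (let w = inv_into V v in
        \<forall>g\<in>G. \<forall>x\<in>V. \<forall>y\<in>V.
          ra' x g = v (ra (w x) g) \<and>
          la' x g = r (ra (w x) g) + la (w x) g + br g (r (w x)) \<and>
          f' x y = f (w x) (w y) + r (cu (w x) (w y)) + br (r (w x)) (r (w y))
            - r (ra (w x) (r (w y))) - la (w x) (r (w y))
            + r (ra (w y) (r (w x))) + la (w y) (r (w x)) \<and>
          cu' x y = v (cu (w x) (w y)) - v (ra (w x) (r (w y))) + v (ra (w y) (r (w x)))))}"

definition H2_equiv ::
  "('k::field \<Rightarrow> 'e::ab_group_add \<Rightarrow> 'e) \<Rightarrow> 'e set \<Rightarrow> ('e \<Rightarrow> 'e \<Rightarrow> 'e) \<Rightarrow> 'e set \<Rightarrow>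
     ('e ext_datum \<times> 'e ext_datum) set" where
  "H2_equiv s G br V = {((ra, la, f, cu), (ra', la', f', cu')).
     (ra, la, f, cu) \<in> lie_ext_structures s G br V \<and>
     (ra', la', f', cu') \<in> lie_ext_structures s G br V \<and>
     (\<exists>r. r \<in> V \<rightarrow> G \<and> linear_on s s V r \<and>
       (\<forall>g\<in>G. \<forall>x\<in>V. \<forall>y\<in>V.
          ra' x g = ra x g \<and>
          la' x g = r (ra x g) + la x g + br g (r x) \<and>
          f' x y = f x y + r (cu x y) + br (r x) (r y)
            - r (ra x (r y)) - la x (r y) + r (ra y (r x)) + la y (r x) \<and>
          cu' x y = cu x y - ra x (r y) + ra y (r x)))}"

definition H2g ::
  "('k::field \<Rightarrow> 'e::ab_group_add \<Rightarrow> 'e) \<Rightarrow> 'e set \<Rightarrow> ('e \<Rightarrow> 'e \<Rightarrow> 'e) \<Rightarrow> 'e set \<Rightarrow>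
     'e ext_datum set set" where
  "H2g s G br V = lie_ext_structures s G br V // H2g_equiv s G br V"

definition H2 ::
  "('k::field \<Rightarrow> 'e::ab_group_add \<Rightarrow> 'e) \<Rightarrow> 'e set \<Rightarrow> ('e \<Rightarrow> 'e \<Rightarrow> 'e) \<Rightarrow> 'e set \<Rightarrow>
     'e ext_datum set set" where
  "H2 s G br V = lie_ext_structures s G br V // H2_equiv s G br V"

definition lie_structures_extending ::
  "('k::field \<Rightarrow> 'e::ab_group_add \<Rightarrow> 'e) \<Rightarrow> 'e set \<Rightarrow> ('e \<Rightarrow> 'e \<Rightarrow> 'e) \<Rightarrow>
     ('e \<Rightarrow> 'e \<Rightarrow> 'e) set" where
  "lie_structures_extending s G br =
     {b. lie_algebra_on s UNIV b \<and> (\<forall>g\<in>G. \<forall>h\<in>G. b g h = br g h)}"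

definition Extd_equiv ::
  "('k::field \<Rightarrow> 'e::ab_group_add \<Rightarrow> 'e) \<Rightarrow> 'e set \<Rightarrow> ('e \<Rightarrow> 'e \<Rightarrow> 'e) \<Rightarrow>
     (('e \<Rightarrow> 'e \<Rightarrow> 'e) \<times> ('e \<Rightarrow> 'e \<Rightarrow> 'e)) set" where
  "Extd_equiv s G br = {(b, b').
     b \<in> lie_structures_extending s G br \<and> b' \<in> lie_structures_extending s G br \<and>
     (\<exists>\<phi>. Vector_Spaces.linear s s \<phi> \<and> bij \<phi> \<and>
       (\<forall>a c. \<phi> (b a c) = b' (\<phi> a) (\<phi> c)) \<and> (\<forall>g\<in>G. \<phi> g = g))}"

definition Extd ::
  "('k::field \<Rightarrow> 'e::ab_group_add \<Rightarrow> 'e) \<Rightarrow> 'e set \<Rightarrow> ('e \<Rightarrow> 'e \<Rightarrow> 'e) \<Rightarrow>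
     ('e \<Rightarrow> 'e \<Rightarrow> 'e) set set" where
  "Extd s G br = lie_structures_extending s G br // Extd_equiv s G br"

subsection \<open>The relations above are equivalence relations\<close>

lemma Extd_equiv_equiv:
  assumes "vector_space s"
  shows "equiv (lie_structures_extending s G br) (Extd_equiv s G br)"
proof (rule equivI)
  interpret vector_space s by fact
  show "Extd_equiv s G br \<subseteq> lie_structures_extending s G br \<times> lie_structures_extending s G br"
    by (auto simp: Extd_equiv_def)
  show "refl_on (lie_structures_extending s G br) (Extd_equiv s G br)"
    by (rule refl_onI) (auto simp: Extd_equiv_def intro!: exI[of _ id] linear_id)
  show "sym (Extd_equiv s G br)"
  proof (rule symI)
    fix b b' assume "(b, b') \<in> Extd_equiv s G br"
    then obtain \<phi> where b: "b \<in> lie_structures_extending s G br" "b' \<in> lie_structures_extending s G br"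
      and \<phi>: "Vector_Spaces.linear s s \<phi>" "bij \<phi>" "\<And>a c. \<phi> (b a c) = b' (\<phi> a) (\<phi> c)"
        "\<forall>g\<in>G. \<phi> g = g"
      unfolding Extd_equiv_def by blast
    interpret \<phi>: Vector_Spaces.linear s s \<phi> by fact
    have inj: "inj \<phi>" and fi: "\<And>z. \<phi> (inv \<phi> z) = z" and invf: "\<And>z. inv \<phi> (\<phi> z) = z"
      using \<phi>(2) by (auto simp: bij_def surj_f_inv_f)
    have lin: "Vector_Spaces.linear s s (inv \<phi>)"
    proof unfold_locales
      show "inv \<phi> (x + y) = inv \<phi> x + inv \<phi> y" for x y
        by (rule injD[OF inj]) (simp add: fi \<phi>.add)
      show "inv \<phi> (s c x) = s c (inv \<phi> x)" for c x
        by (rule injD[OF inj]) (simp add: fi \<phi>.scale)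
    qed
    have hom: "inv \<phi> (b' a c) = b (inv \<phi> a) (inv \<phi> c)" for a c
      by (rule injD[OF inj]) (simp add: fi \<phi>(3))
    have fix_G: "inv \<phi> g = g" if "g \<in> G" for g
      using \<phi>(4) that invf by metis
    show "(b', b) \<in> Extd_equiv s G br"
      unfolding Extd_equiv_def using b lin hom fix_G bij_imp_bij_inv[OF \<phi>(2)] by blast
  qed
  show "trans (Extd_equiv s G br)"
  proof (rule transI)
    fix b b' b'' assume "(b, b') \<in> Extd_equiv s G br" "(b', b'') \<in> Extd_equiv s G br"
    then obtain \<phi> \<psi> where b: "b \<in> lie_structures_extending s G br" "b'' \<in> lie_structures_extending s G br"
      and \<phi>: "Vector_Spaces.linear s s \<phi>" "bij \<phi>" "\<And>a c. \<phi> (b a c) = b' (\<phi> a) (\<phi> c)"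
        "\<forall>g\<in>G. \<phi> g = g"
      and \<psi>: "Vector_Spaces.linear s s \<psi>" "bij \<psi>" "\<And>a c. \<psi> (b' a c) = b'' (\<psi> a) (\<psi> c)"
        "\<forall>g\<in>G. \<psi> g = g"
      unfolding Extd_equiv_def by blast
    have "Vector_Spaces.linear s s (\<psi> \<circ> \<phi>)" "bij (\<psi> \<circ> \<phi>)"
      using Vector_Spaces.linear_compose[OF \<phi>(1) \<psi>(1)] bij_comp[OF \<phi>(2) \<psi>(2)] by auto
    then show "(b, b'') \<in> Extd_equiv s G br"
      unfolding Extd_equiv_def using b \<phi>(3,4) \<psi>(3,4)
      by (auto intro!: exI[of _ "\<psi> \<circ> \<phi>"])
  qed
qed

text \<open>
  Both relations on Lie extending structures say that some map
  \<open>(g, x) \<mapsto> (g + r x, v x)\<close> is an isomorphism of unified products.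
\<close>

definition unified_map :: "('e::ab_group_add \<Rightarrow> 'e) \<Rightarrow> ('e \<Rightarrow> 'e) \<Rightarrow> 'e \<times> 'e \<Rightarrow> 'e \<times> 'e" where
  "unified_map r v = (\<lambda>(g, x). (g + r x, v x))"

definition unified_iso ::
  "('k::field \<Rightarrow> 'e::ab_group_add \<Rightarrow> 'e) \<Rightarrow> 'e set \<Rightarrow> ('e \<Rightarrow> 'e \<Rightarrow> 'e) \<Rightarrow> 'e set \<Rightarrow>
     'e ext_datum \<Rightarrow> 'e ext_datum \<Rightarrow> ('e \<Rightarrow> 'e) \<Rightarrow> ('e \<Rightarrow> 'e) \<Rightarrow> bool" where
  "unified_iso s G br V \<Omega> \<Omega>' r v \<longleftrightarrow>
     r \<in> V \<rightarrow> G \<and> linear_on s s V r \<and> bij_betw v V V \<and> linear_on s s V v \<and>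
     (\<forall>p\<in>G \<times> V. \<forall>q\<in>G \<times> V. unified_map r v (unified_bracket br \<Omega> p q) =
        unified_bracket br \<Omega>' (unified_map r v p) (unified_map r v q))"

lemma unified_bracket_closed:
  assumes "\<Omega> \<in> lie_ext_structures s G br V" "p \<in> G \<times> V" "q \<in> G \<times> V"
  shows "unified_bracket br \<Omega> p q \<in> G \<times> V"
  using assms unfolding lie_ext_structures_def lie_algebra_on_def by blast

lemma unified_iso_refl:
  assumes "vector_space s" "lie_algebra_on s G br"
  shows "unified_iso s G br V \<Omega> \<Omega> (\<lambda>_. 0) (\<lambda>x. x)"
proof -
  interpret vector_space s by fact
  show ?thesis
    using assms(2) by (auto simp: unified_iso_def unified_map_def linear_on_def lie_algebra_on_def
        subspace_0 bij_betw_def)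
qed

lemma unified_iso_sym:
  assumes "vector_space s" "lie_algebra_on s G br" "module.subspace s V"
    and \<Omega>: "\<Omega> \<in> lie_ext_structures s G br V" "\<Omega>' \<in> lie_ext_structures s G br V"
    and iso: "unified_iso s G br V \<Omega> \<Omega>' r v"
    and w: "\<And>x. x \<in> V \<Longrightarrow> w x \<in> V" "\<And>x. x \<in> V \<Longrightarrow> w (v x) = x" "\<And>x. x \<in> V \<Longrightarrow> v (w x) = x"
  shows "unified_iso s G br V \<Omega>' \<Omega> (\<lambda>x. - r (w x)) w"
proof -
  interpret vector_space s by fact
  have G: "subspace G" using assms(2) by (simp add: lie_algebra_on_def)
  have r: "r x \<in> G" "r (x + y) = r x + r y" "r (s c x) = s c (r x)"
    and v: "v x \<in> V" "v (x + y) = v x + v y" "v (s c x) = s c (v x)"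
    if "x \<in> V" "y \<in> V" for x y c
    using iso that by (auto simp: unified_iso_def linear_on_def bij_betw_def)
  have w_add: "w (x + y) = w x + w y" if "x \<in> V" "y \<in> V" for x y
    by (metis assms(3) subspace_add that v(2) w)
  have w_scale: "w (s c x) = s c (w x)" if "x \<in> V" for x c
    by (metis assms(3) subspace_scale that v(3) w)
  have bij: "bij_betw w V V"
    by (rule bij_betw_byWitness[where f' = v]) (use w v in auto)
  let ?\<phi> = "unified_map r v" and ?\<psi> = "unified_map (\<lambda>x. - r (w x)) w"
  have \<phi>: "?\<phi> p \<in> G \<times> V" "?\<psi> p \<in> G \<times> V" "?\<phi> (?\<psi> p) = p" "?\<psi> (?\<phi> p) = p" if "p \<in> G \<times> V" for p
    using that r(1) v(1) w G
    by (auto simp: unified_map_def intro!: subspace_add subspace_diff)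
  have \<phi>_hom: "?\<phi> (unified_bracket br \<Omega> p q) = unified_bracket br \<Omega>' (?\<phi> p) (?\<phi> q)"
    if "p \<in> G \<times> V" "q \<in> G \<times> V" for p q
    using iso that unfolding unified_iso_def by metis
  have "?\<psi> (unified_bracket br \<Omega>' p q) = unified_bracket br \<Omega> (?\<psi> p) (?\<psi> q)"
    if pq: "p \<in> G \<times> V" "q \<in> G \<times> V" for p q
  proof -
    have "?\<phi> (unified_bracket br \<Omega> (?\<psi> p) (?\<psi> q)) = unified_bracket br \<Omega>' (?\<phi> (?\<psi> p)) (?\<phi> (?\<psi> q))"
      using \<phi>_hom[OF \<phi>(2)[OF pq(1)] \<phi>(2)[OF pq(2)]] .
    also have "\<dots> = unified_bracket br \<Omega>' p q" using \<phi>(3) pq by simp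
    finally show ?thesis
      using \<phi>(4)[OF unified_bracket_closed[OF \<Omega>(1) \<phi>(2)[OF pq(1)] \<phi>(2)[OF pq(2)]]] by simp
  qed
  then show ?thesis
    using r w(1) w_add w_scale bij G
    by (auto simp: unified_iso_def linear_on_def intro!: subspace_neg)
qed

lemma unified_iso_trans:
  assumes "vector_space s" "lie_algebra_on s G br"
    and \<Omega>: "\<Omega> \<in> lie_ext_structures s G br V"
    and iso: "unified_iso s G br V \<Omega> \<Omega>' r v" "unified_iso s G br V \<Omega>' \<Omega>'' r' v'"
  shows "unified_iso s G br V \<Omega> \<Omega>'' (\<lambda>x. r x + r' (v x)) (\<lambda>x. v' (v x))"
proof -
  interpret vector_space s by fact
  have G: "subspace G" using assms(2) by (simp add: lie_algebra_on_def)
  have r: "r x \<in> G" "r (x + y) = r x + r y" "r (s c x) = s c (r x)"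
    "r' x \<in> G" "r' (x + y) = r' x + r' y" "r' (s c x) = s c (r' x)"
    and v: "v x \<in> V" "v (x + y) = v x + v y" "v (s c x) = s c (v x)"
     "v' x \<in> V" "v' (x + y) = v' x + v' y" "v' (s c x) = s c (v' x)"
    if "x \<in> V" "y \<in> V" for x y c
    using iso that by (auto simp: unified_iso_def linear_on_def bij_betw_def)
  have bij: "bij_betw (\<lambda>x. v' (v x)) V V"
    using bij_betw_trans[of v V V v' V] iso by (auto simp: unified_iso_def comp_def)
  have comp: "unified_map (\<lambda>x. r x + r' (v x)) (\<lambda>x. v' (v x)) p = unified_map r' v' (unified_map r v p)" for p
    by (cases p) (simp add: unified_map_def algebra_simps)
  have mem: "unified_map r v p \<in> G \<times> V" if "p \<in> G \<times> V" for p
    using that r(1) v(1) G by (auto simp: unified_map_def intro!: subspace_add)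
  have hom: "unified_map r' v' (unified_map r v (unified_bracket br \<Omega> p q)) =
      unified_bracket br \<Omega>'' (unified_map r' v' (unified_map r v p)) (unified_map r' v' (unified_map r v q))"
    if "p \<in> G \<times> V" "q \<in> G \<times> V" for p q
    using iso that mem[OF that(1)] mem[OF that(2)] unfolding unified_iso_def by metis
  show ?thesis
    unfolding unified_iso_def comp
    using r v bij hom G
    by (auto simp: linear_on_def scale_right_distrib intro!: subspace_add)
qed

lemma unified_iso_iff:
  assumes "vector_space s" "lie_algebra_on s G br" "module.subspace s V"
    and \<Omega>: "(ra, la, f, cu) \<in> lie_ext_structures s G br V"
      "(ra', la', f', cu') \<in> lie_ext_structures s G br V"
  shows "unified_iso s G br V (ra, la, f, cu) (ra', la', f', cu') r v \<longleftrightarrow>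
    r \<in> V \<rightarrow> G \<and> linear_on s s V r \<and> bij_betw v V V \<and> linear_on s s V v \<and>
    (\<forall>g\<in>G. \<forall>x\<in>V. \<forall>y\<in>V.
       ra' (v x) g = v (ra x g) \<and>
       la' (v x) g = r (ra x g) + la x g + br g (r x) \<and>
       f' (v x) (v y) = f x y + r (cu x y) + br (r x) (r y)
         - r (ra x (r y)) - la x (r y) + r (ra y (r x)) + la y (r x) \<and>
       cu' (v x) (v y) = v (cu x y) - v (ra x (r y)) + v (ra y (r x)))"
    (is "?L \<longleftrightarrow> ?r1 \<and> ?r2 \<and> ?v1 \<and> ?v2 \<and> ?E")
proof (cases "?r1 \<and> ?r2 \<and> ?v1 \<and> ?v2")
  case False
  then show ?thesis by (auto simp: unified_iso_def)
next
  case lin: True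
  interpret vector_space s by fact
  have G: "subspace G" and br_lin: "bilinear_on s s s G G br" and br_alt: "\<And>g. g \<in> G \<Longrightarrow> br g g = 0"
    and br_cl: "\<And>g h. g \<in> G \<Longrightarrow> h \<in> G \<Longrightarrow> br g h \<in> G"
    using assms(2) by (auto simp: lie_algebra_on_def)
  note V = assms(3)
  have zero: "F 0 = 0" if "linear_on s s A F" "subspace A" for F A
    using that(1) subspace_0[OF that(2)] by (auto simp: linear_on_def) (metis add_cancel_right_left)
  have minus: "F (x - y) = F x - F y" if "linear_on s s A F" "subspace A" "x \<in> A" "y \<in> A" for F A x y
    using that subspace_diff[OF that(2-4)] unfolding linear_on_def
    by (metis add_diff_cancel diff_add_cancel)
  have add: "F (x + y) = F x + F y" if "linear_on s s A F" "x \<in> A" "y \<in> A" for F A x y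
    using that by (simp add: linear_on_def)
  have br_add: "br (g + g') h = br g h + br g' h" "br h (g + g') = br h g + br h g'"
    if "g \<in> G" "g' \<in> G" "h \<in> G" for g g' h
    using br_lin that by (auto simp: bilinear_on_def linear_on_def)
  have br_anti: "br g h = - br h g" if "g \<in> G" "h \<in> G" for g h
  proof -
    have "br (g + h) (g + h) = 0" using that G br_alt subspace_add by blast
    then have "br g h + br h g = 0"
      using that G br_alt[OF that(1)] br_alt[OF that(2)]
      by (simp add: br_add subspace_add add.commute)
    then show ?thesis by (simp add: eq_neg_iff_add_eq_0)
  qed
  have bil: "bilinear_on s s s V G ra" "bilinear_on s s s V G la" "bilinear_on s s s V V f"
     "bilinear_on s s s V V cu"
     "bilinear_on s s s V G ra'" "bilinear_on s s s V G la'" "bilinear_on s s s V V f'"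
     "bilinear_on s s s V V cu'"
    and cl: "\<And>x g. x \<in> V \<Longrightarrow> g \<in> G \<Longrightarrow> ra x g \<in> V"  "\<And>x g. x \<in> V \<Longrightarrow> g \<in> G \<Longrightarrow> la x g \<in> G"
       "\<And>x y. x \<in> V \<Longrightarrow> y \<in> V \<Longrightarrow> f x y \<in> G" "\<And>x y. x \<in> V \<Longrightarrow> y \<in> V \<Longrightarrow> cu x y \<in> V"
    using \<Omega> by (auto simp: lie_ext_structures_def extending_data_def PiE_iff)
  have z1: "B 0 q = 0" if "bilinear_on s s s A C B" "subspace A" "q \<in> C" for A C B q
    using zero[of A "\<lambda>a. B a q"] that by (auto simp: bilinear_on_def)
  have z2: "B p 0 = 0" if "bilinear_on s s s A C B" "subspace C" "p \<in> A" for A C B p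
    using zero[of C "B p"] that by (auto simp: bilinear_on_def)
  have a2: "B p (a + b) = B p a + B p b" if "bilinear_on s s s A C B" "p \<in> A" "a \<in> C" "b \<in> C" for A C B p a b
    using that by (auto simp: bilinear_on_def linear_on_def)
  have r: "\<And>x. x \<in> V \<Longrightarrow> r x \<in> G" "linear_on s s V r" and v: "\<And>x. x \<in> V \<Longrightarrow> v x \<in> V" "linear_on s s V v"
    using lin by (auto dest: bij_betwE)
  note z = zero[OF r(2) V] zero[OF v(2) V] z1[OF br_lin G] z2[OF br_lin G]
    z1[OF bil(1) V] z2[OF bil(1) G] z1[OF bil(2) V] z2[OF bil(2) G]
    z1[OF bil(3) V] z2[OF bil(3) V] z1[OF bil(4) V] z2[OF bil(4) V]
    z1[OF bil(5) V] z2[OF bil(5) G] z1[OF bil(6) V] z2[OF bil(6) G]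
    z1[OF bil(7) V] z2[OF bil(7) V] z1[OF bil(8) V] z2[OF bil(8) V]
  note G0 = subspace_0[OF G] and V0 = subspace_0[OF V]
  show ?thesis
  proof
    assume L: ?L
    have hom: "unified_map r v (unified_bracket br (ra, la, f, cu) (g, x) (h, y)) =
        unified_bracket br (ra', la', f', cu') (unified_map r v (g, x)) (unified_map r v (h, y))"
      if "g \<in> G" "h \<in> G" "x \<in> V" "y \<in> V" for g h x y
      using L that by (simp add: unified_iso_def)
    have 1: "ra' (v x) g = v (ra x g) \<and> la' (v x) g = r (ra x g) + la x g + br g (r x)"
      if "g \<in> G" "x \<in> V" for g x
      using hom[of 0 g x 0] that G0 V0 r(1) v(1) cl br_anti[of g "r x"]
      by (simp add: unified_map_def z algebra_simps)
    have 2: "f' (v x) (v y) = f x y + r (cu x y) + br (r x) (r y)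
         - r (ra x (r y)) - la x (r y) + r (ra y (r x)) + la y (r x) \<and>
       cu' (v x) (v y) = v (cu x y) - v (ra x (r y)) + v (ra y (r x))"
      if "x \<in> V" "y \<in> V" for x y
      using hom[of 0 0 x y] that G0 V0 r(1) v(1) cl 1[of "r x" y] 1[of "r y" x] br_anti[of "r x" "r y"]
      by (simp add: unified_map_def z algebra_simps)
    show "?r1 \<and> ?r2 \<and> ?v1 \<and> ?v2 \<and> ?E" using lin 1 2 by blast
  next
    assume "?r1 \<and> ?r2 \<and> ?v1 \<and> ?v2 \<and> ?E"
    then have E: ?E by blast
    have "unified_map r v (unified_bracket br (ra, la, f, cu) (g, x) (h, y)) =
        unified_bracket br (ra', la', f', cu') (unified_map r v (g, x)) (unified_map r v (h, y))"
      if m: "g \<in> G" "h \<in> G" "x \<in> V" "y \<in> V" for g h x y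
    proof -
      note c = m r(1)[OF m(3)] r(1)[OF m(4)] v(1)[OF m(3)] v(1)[OF m(4)] cl
      have ra': "ra' (v x) (h + r y) = v (ra x h) + v (ra x (r y))"
         "ra' (v y) (g + r x) = v (ra y g) + v (ra y (r x))"
        using E c by (simp_all add: a2[OF bil(5)])
      have la': "la' (v x) (h + r y) = r (ra x h) + la x h + br h (r x)
                  + (r (ra x (r y)) + la x (r y) + br (r y) (r x))"
         "la' (v y) (g + r x) = r (ra y g) + la y g + br g (r y)
                  + (r (ra y (r x)) + la y (r x) + br (r x) (r y))"
        using E c by (simp_all add: a2[OF bil(6)])
      have f': "f' (v x) (v y) = f x y + r (cu x y) + br (r x) (r y)
         - r (ra x (r y)) - la x (r y) + r (ra y (r x)) + la y (r x)"
        and cu': "cu' (v x) (v y) = v (cu x y) - v (ra x (r y)) + v (ra y (r x))"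
        using E m by blast+
      have b: "br (g + r x) (h + r y) = br g h + br g (r y) - br h (r x) + br (r x) (r y)"
        using c G by (simp add: br_add subspace_add br_anti[of "r x" h])
      have rv: "r (cu x y + ra x h - ra y g) = r (cu x y) + r (ra x h) - r (ra y g)"
        "v (cu x y + ra x h - ra y g) = v (cu x y) + v (ra x h) - v (ra y g)"
        using c V by (simp_all add: minus[OF r(2) V] minus[OF v(2) V] add[OF r(2)] add[OF v(2)] subspace_add)
      show ?thesis
        using br_anti[of "r y" "r x"] c
        by (simp add: unified_map_def ra' la' f' cu' b rv)
    qed
    then show ?L using lin by (auto simp: unified_iso_def)
  qed
qed

lemma H2g_equiv_iff:
  assumes "vector_space s" "lie_algebra_on s G br" "module.subspace s V"
  shows "(\<Omega>, \<Omega>') \<in> H2g_equiv s G br V \<longleftrightarrow>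
    \<Omega> \<in> lie_ext_structures s G br V \<and> \<Omega>' \<in> lie_ext_structures s G br V \<and>
    (\<exists>r v. unified_iso s G br V \<Omega> \<Omega>' r v)"
proof -
  obtain ra la f cu where \<Omega>: "\<Omega> = (ra, la, f, cu)" by (cases \<Omega>)
  obtain ra' la' f' cu' where \<Omega>': "\<Omega>' = (ra', la', f', cu')" by (cases \<Omega>')
  have reparam: "(\<forall>g\<in>G. \<forall>x\<in>V. \<forall>y\<in>V. P g x y (inv_into V v x) (inv_into V v y)) \<longleftrightarrow>
      (\<forall>g\<in>G. \<forall>x\<in>V. \<forall>y\<in>V. P g (v x) (v y) x y)" if "bij_betw v V V" for v P
  proof -
    have l: "inv_into V v (v x) = x" and r: "v (inv_into V v x) = x" and c: "v x \<in> V" "inv_into V v x \<in> V"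
      if "x \<in> V" for x
      using \<open>bij_betw v V V\<close> that
      by (auto simp: bij_betw_inv_into_left bij_betw_inv_into_right bij_betw_apply bij_betw_apply[OF bij_betw_inv_into])
    show ?thesis
    proof (intro iffI ballI)
      fix g x y assume "\<forall>g\<in>G. \<forall>x\<in>V. \<forall>y\<in>V. P g x y (inv_into V v x) (inv_into V v y)"
        and m: "g \<in> G" "x \<in> V" "y \<in> V"
      from bspec[OF bspec[OF bspec[OF this(1) m(1)] c(1)[OF m(2)]] c(1)[OF m(3)]]
      show "P g (v x) (v y) x y" using m by (simp add: l)
    next
      fix g x y assume "\<forall>g\<in>G. \<forall>x\<in>V. \<forall>y\<in>V. P g (v x) (v y) x y"
        and m: "g \<in> G" "x \<in> V" "y \<in> V"
      from bspec[OF bspec[OF bspec[OF this(1) m(1)] c(2)[OF m(2)]] c(2)[OF m(3)]]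
      show "P g x y (inv_into V v x) (inv_into V v y)" using m by (simp add: r)
    qed
  qed
  let ?P = "\<lambda>r v g x y a b.
       ra' x g = v (ra a g) \<and>
       la' x g = r (ra a g) + la a g + br g (r a) \<and>
       f' x y = f a b + r (cu a b) + br (r a) (r b)
         - r (ra a (r b)) - la a (r b) + r (ra b (r a)) + la b (r a) \<and>
       cu' x y = v (cu a b) - v (ra a (r b)) + v (ra b (r a))"
  note P = reparam[of _ "?P r v" for r v]
  show ?thesis
    unfolding \<Omega> \<Omega>' H2g_equiv_def
    by (simp add: Let_def unified_iso_iff[OF assms] P cong: conj_cong)
qed

lemma H2_equiv_iff:
  assumes "vector_space s" "lie_algebra_on s G br" "module.subspace s V"
  shows "(\<Omega>, \<Omega>') \<in> H2_equiv s G br V \<longleftrightarrow>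
    \<Omega> \<in> lie_ext_structures s G br V \<and> \<Omega>' \<in> lie_ext_structures s G br V \<and>
    (\<exists>r. unified_iso s G br V \<Omega> \<Omega>' r (\<lambda>x. x))"
proof -
  obtain ra la f cu where \<Omega>: "\<Omega> = (ra, la, f, cu)" by (cases \<Omega>)
  obtain ra' la' f' cu' where \<Omega>': "\<Omega>' = (ra', la', f', cu')" by (cases \<Omega>')
  have id: "bij_betw (\<lambda>x. x) V V" "linear_on s s V (\<lambda>x. x)"
    by (auto simp: bij_betw_def linear_on_def)
  show ?thesis
    unfolding \<Omega> \<Omega>'
    by (auto simp: H2_equiv_def unified_iso_iff[OF assms] id cong: conj_cong)
qed

lemma H2g_equiv_equiv:
  assumes "vector_space s" "lie_algebra_on s G br" "module.subspace s V"
  shows "equiv (lie_ext_structures s G br V) (H2g_equiv s G br V)"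
proof (rule equivI)
  note iff = H2g_equiv_iff[OF assms]
  show "H2g_equiv s G br V \<subseteq> lie_ext_structures s G br V \<times> lie_ext_structures s G br V"
    using iff by auto
  show "refl_on (lie_ext_structures s G br V) (H2g_equiv s G br V)"
    by (rule refl_onI) (use iff unified_iso_refl[OF assms(1,2)] in blast)
  show "sym (H2g_equiv s G br V)"
  proof (rule symI)
    fix \<Omega> \<Omega>' assume "(\<Omega>, \<Omega>') \<in> H2g_equiv s G br V"
    then obtain r v where \<Omega>: "\<Omega> \<in> lie_ext_structures s G br V" "\<Omega>' \<in> lie_ext_structures s G br V"
      and iso: "unified_iso s G br V \<Omega> \<Omega>' r v" unfolding iff by blast
    have "bij_betw v V V" using iso by (simp add: unified_iso_def)
    then show "(\<Omega>', \<Omega>) \<in> H2g_equiv s G br V"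
      unfolding iff using \<Omega> unified_iso_sym[OF assms \<Omega> iso, of "inv_into V v"]
      by (auto simp: bij_betw_inv_into_left bij_betw_inv_into_right bij_betw_apply[OF bij_betw_inv_into])
  qed
  show "trans (H2g_equiv s G br V)"
    using unified_iso_trans[OF assms(1,2)] by (intro transI) (unfold iff, blast)
qed

lemma H2_equiv_equiv:
  assumes "vector_space s" "lie_algebra_on s G br" "module.subspace s V"
  shows "equiv (lie_ext_structures s G br V) (H2_equiv s G br V)"
proof (rule equivI)
  note iff = H2_equiv_iff[OF assms]
  show "H2_equiv s G br V \<subseteq> lie_ext_structures s G br V \<times> lie_ext_structures s G br V"
    using iff by auto
  show "refl_on (lie_ext_structures s G br V) (H2_equiv s G br V)"
    by (rule refl_onI) (use iff unified_iso_refl[OF assms(1,2)] in blast)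
  show "sym (H2_equiv s G br V)"
    using unified_iso_sym[OF assms, where v = "\<lambda>x. x" and w = "\<lambda>x. x"]
    by (intro symI) (unfold iff, blast)
  show "trans (H2_equiv s G br V)"
    using unified_iso_trans[OF assms(1,2), where v = "\<lambda>x. x" and v' = "\<lambda>x. x"]
    by (intro transI) (unfold iff, blast)
qed

end

theory Submission
  imports Defs
begin

text \<open>
  Each bijection identifies the quotients of two sets by equivalence relations.  It comes from a
  map of one set onto the other that both preserves and reflects the relations
  (\<open>bij_betw_quotients\<close>), and two such maps are enough.

  The first one, valid for a complement \<open>V\<close> of any dimension, sends a Lie extending structure to
  its unified product, read as a bracket on \<open>E\<close>.  It is onto: a bracket \<open>b\<close> on \<open>E\<close> extending
  the one of \<open>G\<close> is the unified product of the \<open>G\<close>- and \<open>V\<close>-components of \<open>b x g\<close> and \<open>b x y\<close>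
  (\<open>x\<close>, \<open>y\<close> in \<open>V\<close>, \<open>g\<close> in \<open>G\<close>).  A linear map of \<open>E\<close> that fixes \<open>G\<close> pointwise has the
  form \<open>g + x \<mapsto> g + r x + v x\<close>, and it is bijective exactly if \<open>v\<close> is; so the
  isomorphisms that fix \<open>G\<close> pointwise are the isomorphisms \<open>(r, v)\<close> of unified products
  (\<open>Extd_equiv_iff\<close>).

  The second one is \<open>(l, D) \<mapsto> Omega (l, D)\<close>, for \<open>V\<close> spanned by one vector \<open>x\<close>.  It maps
  the twisted derivations onto the Lie extending structures.  Since an alternating
  bilinear map on a line vanishes, both \<open>f\<close> and the bracket of \<open>V\<close> are zero; the two actions are
  determined by \<open>x \<triangleleft> g = l g x\<close> and \<open>x \<triangleright> g = D g\<close>, and the Jacobi identity for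
  \<open>x\<close>, \<open>g\<close>, \<open>h\<close> is, component by component, the definition of a twisted derivation
  (\<open>Omega_surj\<close>, \<open>Omega_mem\<close>).  Writing \<open>r x = g\<^sub>0\<close> and \<open>v x = q x\<close>, the conditions for
  \<open>(r, v)\<close> to be an isomorphism reduce to \<open>l = l'\<close> and
  \<open>D h = q D' h + [g\<^sub>0, h] - l h g\<^sub>0\<close> (\<open>Omega_iso_iff\<close>).  Arbitrary \<open>q \<noteq> 0\<close> gives \<open>\<equiv>\<close>, and
  \<open>q = 1\<close>, that is \<open>v = id\<close>, gives \<open>\<approx>\<close>.  In particular both relations are pulled back
  from equivalence relations, hence are equivalence relations themselves.
\<close>

section \<open>Quotients by pulled-back equivalence relations\<close>

lemma equiv_pullback:
  assumes "equiv B S" and "h \<in> A \<rightarrow> B" and "R \<subseteq> A \<times> A"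
    and "\<And>p q. p \<in> A \<Longrightarrow> q \<in> A \<Longrightarrow> (p, q) \<in> R \<longleftrightarrow> (h p, h q) \<in> S"
  shows "equiv A R"
proof (rule equivI)
  show "R \<subseteq> A \<times> A" by fact
  have S: "refl_on B S" "sym S" "trans S" using assms(1) by (auto simp: equiv_def)
  show "refl_on A R" using S(1) assms(2,4) by (auto simp: refl_on_def)
  show "sym R" using S(2) assms(3,4) by (auto simp: sym_def)
  show "trans R"
  proof (rule transI)
    fix p q r assume pq: "(p, q) \<in> R" and qr: "(q, r) \<in> R"
    then have "p \<in> A" "q \<in> A" "r \<in> A" using assms(3) by auto
    then show "(p, r) \<in> R" using pq qr assms(4) transD[OF S(3)] by blast
  qed
qed

lemma bij_betw_quotients:
  assumes R: "equiv A R" and S: "equiv B S" and surj: "h ` A = B"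
    and iff: "\<And>p q. p \<in> A \<Longrightarrow> q \<in> A \<Longrightarrow> (p, q) \<in> R \<longleftrightarrow> (h p, h q) \<in> S"
  shows "\<exists>F. bij_betw F (A // R) (B // S) \<and> (\<forall>p\<in>A. F (R `` {p}) = S `` {h p})"
proof -
  define F where "F X = S `` (h ` X)" for X
  have F: "F (R `` {p}) = S `` {h p}" if p: "p \<in> A" for p
  proof -
    have "h p \<in> h ` (R `` {p})" using p equiv_class_self[OF R] by blast
    moreover have "S `` {h q} = S `` {h p}" if "q \<in> R `` {p}" for q
      using that p iff equiv_type[OF R] equiv_class_eq[OF S, of "h p" "h q"] by auto
    ultimately show ?thesis unfolding F_def by blast
  qed
  have "inj_on F (A // R)"
  proof (rule inj_onI)
    fix X Y assume XY: "X \<in> A // R" "Y \<in> A // R" and eq: "F X = F Y"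
    obtain p q where X: "X = R `` {p}" and Y: "Y = R `` {q}" and pq: "p \<in> A" "q \<in> A"
      using XY by (auto elim!: quotientE)
    have "(h p, h q) \<in> S"
      using eq pq surj eq_equiv_class_iff[OF S, of "h p" "h q"] by (auto simp: X Y F)
    then show "X = Y" using pq iff equiv_class_eq[OF R] by (simp add: X Y)
  qed
  moreover have "F ` (A // R) = B // S"
    using F surj by (force simp: quotient_def image_UN)
  ultimately show ?thesis using F by (auto simp: bij_betw_def)
qed

section \<open>Lie brackets on subspaces\<close>

lemma linear_on_zero:
  assumes "linear_on s1 s2 A f" "(0::'a::ab_group_add) \<in> A"
  shows "f 0 = (0::'b::ab_group_add)"
proof -
  have "f (0 + 0) = f 0 + f 0" using assms by (simp only: linear_on_def)
  then show ?thesis by simp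
qed

text \<open>
  The Lie axioms pass to the image of a surjective homomorphism, because each of them is an identity
  between values of the bracket.  The lemma moves Lie structures between \<open>G \<times> V\<close> and \<open>E\<close> in both
  directions.
\<close>

lemma lie_algebra_on_hom_image:
  fixes s1 :: "'k::field \<Rightarrow> 'a::ab_group_add \<Rightarrow> 'a" and s2 :: "'k \<Rightarrow> 'b::ab_group_add \<Rightarrow> 'b"
  assumes "module s1" and "module s2" and lie: "lie_algebra_on s1 L b"
    and lin: "linear_on s1 s2 L \<phi>" and M: "\<phi> ` L = M"
    and hom: "\<And>x y. x \<in> L \<Longrightarrow> y \<in> L \<Longrightarrow> b' (\<phi> x) (\<phi> y) = \<phi> (b x y)"
  shows "lie_algebra_on s2 M b'"
proof -
  interpret m1: module s1 by fact
  interpret m2: module s2 by fact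
  have L: "m1.subspace L" and cl: "\<And>x y. x \<in> L \<Longrightarrow> y \<in> L \<Longrightarrow> b x y \<in> L"
    and bil: "bilinear_on s1 s1 s1 L L b" and alt: "\<And>x. x \<in> L \<Longrightarrow> b x x = 0"
    and jac: "\<And>x y z. x \<in> L \<Longrightarrow> y \<in> L \<Longrightarrow> z \<in> L \<Longrightarrow> b x (b y z) + b y (b z x) + b z (b x y) = 0"
    using lie by (auto simp: lie_algebra_on_def Pi_iff)
  note sub = m1.subspace_add[OF L] m1.subspace_scale[OF L] m1.subspace_0[OF L]
  have \<phi>_add: "\<phi> x + \<phi> y = \<phi> (x + y)" if "x \<in> L" "y \<in> L" for x y
    using lin that by (simp add: linear_on_def)
  have \<phi>_scale: "s2 c (\<phi> x) = \<phi> (s1 c x)" if "x \<in> L" for c x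
    using lin that by (simp add: linear_on_def)
  have \<phi>_0: "\<phi> 0 = 0" by (rule linear_on_zero[OF lin sub(3)])
  note [simp] = hom \<phi>_add \<phi>_scale sub cl
  have "m2.subspace M"
    unfolding M[symmetric] m2.subspace_def using \<phi>_0 sub(3) by (force intro: image_eqI)
  moreover have "b' \<in> M \<rightarrow> M \<rightarrow> M" unfolding M[symmetric] by auto
  moreover have "bilinear_on s2 s2 s2 M M b'"
    using bil unfolding M[symmetric] by (auto simp: bilinear_on_def linear_on_def)
  moreover have "\<forall>x\<in>M. b' x x = 0" unfolding M[symmetric] by (auto simp: alt \<phi>_0)
  moreover have "\<forall>x\<in>M. \<forall>y\<in>M. \<forall>z\<in>M. b' x (b' y z) + b' y (b' z x) + b' z (b' x y) = 0"
    unfolding M[symmetric] by (auto simp: jac \<phi>_0)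
  ultimately show ?thesis by (simp add: lie_algebra_on_def)
qed

lemma lie_algebra_on_anti:
  assumes "module s" "lie_algebra_on s L b" and m: "x \<in> L" "y \<in> L"
  shows "b x y = - b y x"
proof -
  have "x + y \<in> L" using assms by (simp add: lie_algebra_on_def module.subspace_add)
  then have "0 = b (x + y) (x + y)" and "b x x = 0" "b y y = 0"
    using assms(2) m by (simp_all add: lie_algebra_on_def)
  moreover have "b (x + y) (x + y) = b x (x + y) + b y (x + y)"
    and "b x (x + y) = b x x + b x y" and "b y (x + y) = b y x + b y y"
    using assms(2) m \<open>x + y \<in> L\<close>
    unfolding lie_algebra_on_def bilinear_on_def linear_on_def by blast+
  ultimately have "b x y + b y x = 0" by simp
  then show ?thesis by (simp only: eq_neg_iff_add_eq_0)
qed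

section \<open>Unified products are the Lie algebra structures on the ambient space\<close>

locale lie_complement = vector_space s
  for s :: "'k::field \<Rightarrow> 'e::ab_group_add \<Rightarrow> 'e" +
  fixes G V :: "'e set" and br :: "'e \<Rightarrow> 'e \<Rightarrow> 'e"
  assumes lie: "lie_algebra_on s G br" and compl: "complement_of s G V"
begin

lemma vs: "vector_space s" ..

lemma G: "subspace G" and V: "subspace V"
  using lie compl by (auto simp: lie_algebra_on_def complement_of_def)

lemmas G_closed [simp, intro] = subspace_0[OF G] subspace_add[OF G] subspace_diff[OF G]
    subspace_neg[OF G] subspace_scale[OF G]
  and V_closed [simp, intro] = subspace_0[OF V] subspace_add[OF V] subspace_diff[OF V]
    subspace_neg[OF V] subspace_scale[OF V]

lemma br_closed [simp, intro]: "g \<in> G \<Longrightarrow> h \<in> G \<Longrightarrow> br g h \<in> G"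
  using lie by (auto simp: lie_algebra_on_def)

lemma br_bilinear:
  shows "g \<in> G \<Longrightarrow> g' \<in> G \<Longrightarrow> h \<in> G \<Longrightarrow> br (g + g') h = br g h + br g' h"
    and "g \<in> G \<Longrightarrow> g' \<in> G \<Longrightarrow> h \<in> G \<Longrightarrow> br h (g + g') = br h g + br h g'"
    and "g \<in> G \<Longrightarrow> h \<in> G \<Longrightarrow> br (s c g) h = s c (br g h)"
    and "g \<in> G \<Longrightarrow> h \<in> G \<Longrightarrow> br h (s c g) = s c (br h g)"
  using lie by (auto simp: lie_algebra_on_def bilinear_on_def linear_on_def)

lemma br_diff:
  assumes "g \<in> G" "g' \<in> G" "h \<in> G"
  shows "br (g - g') h = br g h - br g' h" "br h (g - g') = br h g - br h g'"
  using br_bilinear(1)[of "g - g'" g' h] br_bilinear(2)[of "g - g'" g' h] assms by simp_all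

lemma br_alt: "g \<in> G \<Longrightarrow> br g g = 0"
  using lie by (simp add: lie_algebra_on_def)

lemma br_anti:
  assumes "g \<in> G" "h \<in> G" shows "br g h = - br h g"
  by (rule lie_algebra_on_anti[OF module_axioms lie assms])

lemma br_jacobi:
  "g \<in> G \<Longrightarrow> h \<in> G \<Longrightarrow> k \<in> G \<Longrightarrow> br g (br h k) + br h (br k g) + br k (br g h) = 0"
  using lie by (simp add: lie_algebra_on_def)

definition join :: "'e \<times> 'e \<Rightarrow> 'e" where "join p = fst p + snd p"

text \<open>
  The two components of a vector along \<open>E = G \<oplus> V\<close>.  The right-hand side is the inverse that occurs
  in \<open>unified_structure\<close>, so that both can be matched literally.
\<close>

definition split :: "'e \<Rightarrow> 'e \<times> 'e" where "split = the_inv_into (G \<times> V) (\<lambda>(g, x). g + x)"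

lemma join_bij: "bij_betw join (G \<times> V) UNIV"
  unfolding bij_betw_def
proof
  have "p = q" if eq: "join p = join q" and p: "p \<in> G \<times> V" and q: "q \<in> G \<times> V" for p q
  proof -
    have m: "fst p \<in> G" "fst q \<in> G" "snd p \<in> V" "snd q \<in> V" using p q by auto
    have d: "fst p - fst q = snd q - snd p" using eq by (simp add: join_def algebra_simps)
    have "fst p - fst q \<in> G" "snd q - snd p \<in> V" using m by simp_all
    then have "fst p - fst q \<in> V \<inter> G" using d by simp
    then have "fst p - fst q = 0" using compl unfolding complement_of_def by blast
    then show ?thesis using d by (simp add: prod_eq_iff)
  qed
  then show "inj_on join (G \<times> V)" by (intro inj_onI)
  have "a \<in> join ` (G \<times> V)" for a
  proof -
    have "a \<in> {a + u | a u. a \<in> G \<and> u \<in> V}" using compl by (simp add: complement_of_def)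
    then obtain g u where "g \<in> G" "u \<in> V" "a = join (g, u)" by (auto simp: join_def)
    then show ?thesis by blast
  qed
  then show "join ` (G \<times> V) = UNIV" by blast
qed

lemma join_eq: "(\<lambda>(g, x). g + x) = join" by (auto simp: join_def)

lemma split_mem [simp, intro]: "split a \<in> G \<times> V"
  and join_split [simp]: "join (split a) = a"
  and split_join [simp]: "p \<in> G \<times> V \<Longrightarrow> split (join p) = p"
proof -
  have inj: "inj_on join (G \<times> V)" and im: "join ` (G \<times> V) = UNIV"
    using join_bij by (simp_all only: bij_betw_def)
  show "split a \<in> G \<times> V"
    unfolding split_def join_eq by (rule the_inv_into_into[OF inj]) (simp_all only: im UNIV_I subset_refl)
  show "join (split a) = a"
    unfolding split_def join_eq by (rule f_the_inv_into_f[OF inj]) (simp only: im UNIV_I)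
  show "p \<in> G \<times> V \<Longrightarrow> split (join p) = p"
    unfolding split_def join_eq by (rule the_inv_into_f_f[OF inj])
qed

lemma fst_split [simp, intro]: "fst (split a) \<in> G" and snd_split [simp, intro]: "snd (split a) \<in> V"
  using split_mem[of a] by (simp_all only: mem_Times_iff)

lemma split_add: "g \<in> G \<Longrightarrow> x \<in> V \<Longrightarrow> split (g + x) = (g, x)"
  using split_join[of "(g, x)"] by (simp add: join_def)

lemma split_G: "g \<in> G \<Longrightarrow> split g = (g, 0)" and split_V: "x \<in> V \<Longrightarrow> split x = (0, x)"
  using split_add[of g 0] split_add[of 0 x] by simp_all

lemma split_linear: "linear_on s (module_prod.scale s s) UNIV split"
  and join_linear: "linear_on (module_prod.scale s s) s (G \<times> V) join"
proof -
  interpret vector_space_prod s s ..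
  show join: "linear_on (module_prod.scale s s) s (G \<times> V) join"
    by (auto simp: linear_on_def join_def scale_def scale_right_distrib algebra_simps)
  have "split (a + c) = split a + split c" for a c
  proof -
    have "split (join (split a + split c)) = split a + split c"
      by (rule split_join) (auto simp: mem_Times_iff)
    moreover have "join (split a + split c) = join (split a) + join (split c)"
      by (simp add: join_def algebra_simps)
    ultimately show ?thesis by simp
  qed
  moreover have "split (s k a) = scale k (split a)" for k a
  proof -
    have "split (join (scale k (split a))) = scale k (split a)"
      by (rule split_join) (auto simp: mem_Times_iff scale_def)
    moreover have "join (scale k (split a)) = s k (join (split a))"
      by (simp add: join_def scale_def scale_right_distrib)
    ultimately show ?thesis by simp
  qed
  ultimately show "linear_on s (module_prod.scale s s) UNIV split"
    by (simp add: linear_on_def)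
qed

abbreviation "bracket_of \<equiv> unified_structure G br V"

lemma unified_structure_join:
  "p \<in> G \<times> V \<Longrightarrow> q \<in> G \<times> V \<Longrightarrow> bracket_of \<Omega> (join p) (join q) = join (unified_bracket br \<Omega> p q)"
  by (simp add: unified_structure_def Let_def join_eq flip: split_def[unfolded join_eq])

lemma split_unified_structure:
  "\<Omega> \<in> lie_ext_structures s G br V \<Longrightarrow> split (bracket_of \<Omega> a c) = unified_bracket br \<Omega> (split a) (split c)"
  using unified_structure_join[of "split a" "split c"] by (simp add: unified_bracket_closed)

lemma ext_datum_zero:
  assumes "(ra, la, f, cu) \<in> extending_data s G V"
  shows "g \<in> G \<Longrightarrow> ra 0 g = 0" "x \<in> V \<Longrightarrow> ra x 0 = 0"
    "g \<in> G \<Longrightarrow> la 0 g = 0" "x \<in> V \<Longrightarrow> la x 0 = 0"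
    "x \<in> V \<Longrightarrow> f 0 x = 0" "x \<in> V \<Longrightarrow> f x 0 = 0"
    "x \<in> V \<Longrightarrow> cu 0 x = 0" "x \<in> V \<Longrightarrow> cu x 0 = 0"
  using assms by (auto simp: extending_data_def bilinear_on_def
      intro: linear_on_zero[OF _ G_closed(1)] linear_on_zero[OF _ V_closed(1)]
        linear_on_zero[where f = "\<lambda>u. F u g" for F g, OF _ V_closed(1)])

lemma br_zero: "g \<in> G \<Longrightarrow> br g 0 = 0" "g \<in> G \<Longrightarrow> br 0 g = 0"
  using br_bilinear(3,4)[of g g 0] by simp_all

lemma unified_bracket_G:
  assumes "\<Omega> \<in> extending_data s G V" "g \<in> G" "h \<in> G"
  shows "unified_bracket br \<Omega> (g, 0) (h, 0) = (br g h, 0)"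
  using assms by (cases \<Omega>) (simp add: ext_datum_zero)

lemma unified_structure_mem:
  assumes "\<Omega> \<in> lie_ext_structures s G br V"
  shows "bracket_of \<Omega> \<in> lie_structures_extending s G br"
proof -
  interpret vector_space_prod s s ..
  have "lie_algebra_on s UNIV (bracket_of \<Omega>)"
  proof (rule lie_algebra_on_hom_image[OF _ _ _ join_linear])
    show "lie_algebra_on scale (G \<times> V) (unified_bracket br \<Omega>)"
      using assms by (simp add: lie_ext_structures_def)
  qed (use join_bij in \<open>simp_all add: bij_betw_def unified_structure_join p.module_axioms module_axioms\<close>)
  moreover have "bracket_of \<Omega> g h = br g h" if "g \<in> G" "h \<in> G" for g h
    using unified_structure_join[of "(g, 0)" "(h, 0)" \<Omega>] that assms
    by (simp add: join_def unified_bracket_G lie_ext_structures_def)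
  ultimately show ?thesis by (simp add: lie_structures_extending_def)
qed

lemma extending_data_eqI:
  assumes "(ra, la, f, cu) \<in> extending_data s G V" "(ra', la', f', cu') \<in> extending_data s G V"
    and "\<And>x g. x \<in> V \<Longrightarrow> g \<in> G \<Longrightarrow> la x g = la' x g"
    and "\<And>x g. x \<in> V \<Longrightarrow> g \<in> G \<Longrightarrow> ra x g = ra' x g"
    and "\<And>x y. x \<in> V \<Longrightarrow> y \<in> V \<Longrightarrow> f x y = f' x y"
    and "\<And>x y. x \<in> V \<Longrightarrow> y \<in> V \<Longrightarrow> cu x y = cu' x y"
  shows "(ra, la, f, cu) = (ra', la', f', cu')"
proof -
  have ext: "F = F'" if F: "F \<in> A \<rightarrow>\<^sub>E B \<rightarrow>\<^sub>E C" and F': "F' \<in> A \<rightarrow>\<^sub>E B \<rightarrow>\<^sub>E C"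
    and eq: "\<And>a b. a \<in> A \<Longrightarrow> b \<in> B \<Longrightarrow> F a b = F' a b" for F F' :: "'e \<Rightarrow> 'e \<Rightarrow> 'e" and A B C
  proof (rule PiE_ext[OF F F'])
    fix a assume a: "a \<in> A"
    show "F a = F' a"
      by (rule PiE_ext[OF PiE_mem[OF F a] PiE_mem[OF F' a]]) (rule eq[OF a])
  qed
  have "ra = ra'" using assms(1,2) by (intro ext[of _ V G V]) (simp_all add: extending_data_def assms(4))
  moreover have "la = la'" using assms(1,2) by (intro ext[of _ V G G]) (simp_all add: extending_data_def assms(3))
  moreover have "f = f'" using assms(1,2) by (intro ext[of _ V V G]) (simp_all add: extending_data_def assms(5))
  moreover have "cu = cu'" using assms(1,2) by (intro ext[of _ V V V]) (simp_all add: extending_data_def assms(6))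
  ultimately show ?thesis by simp
qed

lemma unified_structure_surj:
  assumes "b \<in> lie_structures_extending s G br"
  shows "\<exists>\<Omega>\<in>lie_ext_structures s G br V. bracket_of \<Omega> = b"
proof -
  interpret vector_space_prod s s ..
  have lie_b: "lie_algebra_on s UNIV b" and ext: "\<And>g h. g \<in> G \<Longrightarrow> h \<in> G \<Longrightarrow> b g h = br g h"
    using assms by (auto simp: lie_structures_extending_def)
  have add: "b (a + a') c = b a c + b a' c" "b c (a + a') = b c a + b c a'"
    and scl: "b (s k a) c = s k (b a c)" "b c (s k a) = s k (b c a)" for a a' c k
    using lie_b by (auto simp: lie_algebra_on_def bilinear_on_def linear_on_def)
  have anti: "b a c = - b c a" for a c
    by (rule lie_algebra_on_anti[OF module_axioms lie_b]) simp_all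
  have spl: "split (a + c) = split a + split c" "split (s k a) = scale k (split a)" for a c k
    using split_linear by (auto simp: linear_on_def)
  have diff: "split (a - c) = split a - split c" for a c
    using spl(1)[of "a - c" c] by simp
  define \<Omega> where "\<Omega> =
     (\<lambda>x\<in>V. \<lambda>g\<in>G. snd (split (b x g)), \<lambda>x\<in>V. \<lambda>g\<in>G. fst (split (b x g)),
      \<lambda>x\<in>V. \<lambda>y\<in>V. fst (split (b x y)), \<lambda>x\<in>V. \<lambda>y\<in>V. snd (split (b x y)))"
  have "\<Omega> \<in> extending_data s G V"
    unfolding \<Omega>_def extending_data_def
    by (auto simp: bilinear_on_def linear_on_def add scl spl scale_def)
  moreover have ub: "unified_bracket br \<Omega> p q = split (b (join p) (join q))" if "p \<in> G \<times> V" "q \<in> G \<times> V" for p q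
  proof -
    obtain g x where p: "p = (g, x)" by (cases p)
    obtain h y where q: "q = (h, y)" by (cases q)
    note pq = p q
    have m: "g \<in> G" "x \<in> V" "h \<in> G" "y \<in> V" using that by (simp_all add: pq)
    have "split (b (g + x) (h + y)) = split (br g h) + split (b x h) - split (b y g) + split (b x y)"
      using m by (simp add: add ext anti[of g y] algebra_simps) (simp add: spl diff)
    also have "\<dots> = unified_bracket br \<Omega> p q"
      using m by (simp add: pq \<Omega>_def split_G prod_eq_iff algebra_simps)
    finally show ?thesis by (simp add: pq join_def)
  qed
  \<comment> \<open>The Lie axioms are inherited from \<open>b\<close> along \<open>split\<close>, with no computation.\<close>
  moreover have "lie_algebra_on scale (G \<times> V) (unified_bracket br \<Omega>)"
  proof (rule lie_algebra_on_hom_image[OF _ _ lie_b split_linear])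
    show "range split = G \<times> V"
    proof
      show "G \<times> V \<subseteq> range split"
      proof
        fix p assume "p \<in> G \<times> V"
        then have "p = split (join p)" by simp
        then show "p \<in> range split" by (rule range_eqI)
      qed
    qed (simp add: image_subsetI)
  qed (auto simp: ub intro: p.module_axioms module_axioms)
  ultimately have m: "\<Omega> \<in> lie_ext_structures s G br V" by (simp add: lie_ext_structures_def)
  have "bracket_of \<Omega> a c = b a c" for a c
    using unified_structure_join[of "split a" "split c" \<Omega>] by (simp add: ub)
  then show ?thesis using m by blast
qed

lemma unified_structure_image: "bracket_of ` lie_ext_structures s G br V = lie_structures_extending s G br"
  using unified_structure_mem unified_structure_surj by (fastforce simp: image_iff)

text \<open>
  Conjugation by \<open>join\<close> turns \<open>(g, x) \<mapsto> (g + r x, v x)\<close> into a linear map of \<open>E\<close> that fixes \<open>G\<close>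
  pointwise, and every such map arises: \<open>r\<close> and \<open>v\<close> are the components of its restriction to \<open>V\<close>.
\<close>

lemma Extd_equiv_iff:
  assumes m: "\<Omega> \<in> lie_ext_structures s G br V" "\<Omega>' \<in> lie_ext_structures s G br V"
  shows "(bracket_of \<Omega>, bracket_of \<Omega>') \<in> Extd_equiv s G br \<longleftrightarrow> (\<Omega>, \<Omega>') \<in> H2g_equiv s G br V"
proof
  interpret vector_space_prod s s ..
  assume "(\<Omega>, \<Omega>') \<in> H2g_equiv s G br V"
  then obtain r v where iso: "unified_iso s G br V \<Omega> \<Omega>' r v"
    unfolding H2g_equiv_iff[OF vs lie V] by blast
  then have r: "x \<in> V \<Longrightarrow> r x \<in> G" and r_lin: "linear_on s s V r"
    and v_bij: "bij_betw v V V" and v_lin: "linear_on s s V v" for x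
    by (auto simp: unified_iso_def)
  define w where "w = inv_into V v"
  have v: "v x \<in> V" and w: "w x \<in> V" and wv: "w (v x) = x" and vw: "v (w x) = x" if "x \<in> V" for x
    using that v_bij bij_betw_inv_into_left[OF v_bij] bij_betw_inv_into_right[OF v_bij]
      bij_betw_apply[OF bij_betw_inv_into[OF v_bij]]
    by (simp_all add: w_def bij_betw_apply)
  have um: "unified_map r v p \<in> G \<times> V" if "p \<in> G \<times> V" for p
    using that by (cases p) (simp add: unified_map_def r v)
  define \<Phi> where "\<Phi> a = join (unified_map r v (split a))" for a
  have \<Phi>_eq: "\<Phi> a = fst (split a) + r (snd (split a)) + v (snd (split a))" for a
    by (simp add: \<Phi>_def join_def unified_map_def case_prod_beta)
  have spl: "split (a + c) = split a + split c" "split (s k a) = scale k (split a)" for a c k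
    using split_linear by (auto simp: linear_on_def)
  have lin: "Vector_Spaces.linear s s \<Phi>"
  proof unfold_locales
    show "\<Phi> (a + c) = \<Phi> a + \<Phi> c" for a c
      using r_lin v_lin by (simp add: \<Phi>_eq spl linear_on_def algebra_simps)
    show "\<Phi> (s k a) = s k (\<Phi> a)" for k a
      using r_lin v_lin by (simp add: \<Phi>_eq spl scale_def linear_on_def scale_right_distrib)
  qed
  have bij: "bij \<Phi>"
  proof (rule bij_betw_byWitness)
    \<comment> \<open>The inverse map subtracts \<open>r\<close> at the preimage under \<open>v\<close>.\<close>
    let ?\<Psi> = "\<lambda>a. fst (split a) - r (w (snd (split a))) + w (snd (split a))"
    have "split (\<Phi> a) = (fst (split a) + r (snd (split a)), v (snd (split a)))" for a
      unfolding \<Phi>_eq by (rule split_add) (simp_all add: r v)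
    then show "\<forall>a\<in>UNIV. ?\<Psi> (\<Phi> a) = a"
      using join_split by (simp add: wv join_def)
    have "split (?\<Psi> a) = (fst (split a) - r (w (snd (split a))), w (snd (split a)))" for a
      by (rule split_add) (simp_all add: r w)
    then show "\<forall>a\<in>UNIV. \<Phi> (?\<Psi> a) = a"
      using join_split by (simp add: \<Phi>_eq vw join_def)
  qed simp_all
  have hom: "\<Phi> (bracket_of \<Omega> a c) = bracket_of \<Omega>' (\<Phi> a) (\<Phi> c)" for a c
    using iso unified_structure_join[OF um um, of "split a" "split c" \<Omega>']
    by (simp only: \<Phi>_def split_unified_structure[OF m(1)] split_mem unified_iso_def)
  have "\<Phi> g = g" if "g \<in> G" for g
    using that linear_on_zero[OF r_lin] linear_on_zero[OF v_lin] by (simp add: \<Phi>_eq split_G)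
  then show "(bracket_of \<Omega>, bracket_of \<Omega>') \<in> Extd_equiv s G br"
    unfolding Extd_equiv_def using unified_structure_mem m lin bij hom by blast
next
  interpret vector_space_prod s s ..
  assume "(bracket_of \<Omega>, bracket_of \<Omega>') \<in> Extd_equiv s G br"
  then obtain \<Phi> where lin: "Vector_Spaces.linear s s \<Phi>" and bij: "bij \<Phi>"
    and hom: "\<And>a c. \<Phi> (bracket_of \<Omega> a c) = bracket_of \<Omega>' (\<Phi> a) (\<Phi> c)" and fix_G: "\<And>g. g \<in> G \<Longrightarrow> \<Phi> g = g"
    unfolding Extd_equiv_def by blast
  interpret \<Phi>: Vector_Spaces.linear s s \<Phi> by fact
  have spl: "split (a + c) = split a + split c" "split (s k a) = scale k (split a)" for a c k
    using split_linear by (auto simp: linear_on_def)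
  define r v where "r x = fst (split (\<Phi> x))" and "v x = snd (split (\<Phi> x))" for x
  have \<Phi>_eq: "\<Phi> x = r x + v x" for x
    using join_split[of "\<Phi> x"] by (simp add: r_def v_def join_def)
  have rv: "r x \<in> G" "v x \<in> V" for x by (simp_all add: r_def v_def)
  have um: "split (\<Phi> (join p)) = unified_map r v p" if "p \<in> G \<times> V" for p
  proof -
    have "\<Phi> (join p) = (fst p + r (snd p)) + v (snd p)"
      using that by (auto simp: join_def \<Phi>.add fix_G \<Phi>_eq[of "snd p"])
    moreover have "split ((fst p + r (snd p)) + v (snd p)) = (fst p + r (snd p), v (snd p))"
      using that by (intro split_add) (auto simp: rv)
    ultimately show ?thesis by (simp add: unified_map_def case_prod_beta)
  qed
  have inj: "inj_on v V"
  proof (rule inj_onI)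
    fix x y assume xy: "x \<in> V" "y \<in> V" "v x = v y"
    \<comment> \<open>If \<open>v x = v y\<close>, then \<open>\<Phi> x\<close> and \<open>\<Phi> y\<close> differ by an element of \<open>G\<close>, which \<open>\<Phi>\<close> fixes.\<close>
    then have "\<Phi> (y + (r x - r y)) = \<Phi> x"
      by (simp add: \<Phi>.add fix_G rv) (simp add: \<Phi>_eq)
    then have "y + (r x - r y) = x" using bij by (simp add: bij_def inj_eq)
    then have "split ((r x - r y) + y) = split x" by (simp add: add.commute)
    then show "x = y" using xy by (simp add: split_add split_V rv)
  qed
  have "y \<in> v ` V" if "y \<in> V" for y
  proof -
    obtain a where a: "\<Phi> a = y" using bij by (metis bij_pointE)
    have "split (\<Phi> (join (split a))) = unified_map r v (split a)" by (rule um) simp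
    then have "v (snd (split a)) = y" using a that by (simp add: split_V unified_map_def case_prod_beta)
    then show ?thesis by (metis imageI snd_split)
  qed
  then have "bij_betw v V V" using inj rv by (auto simp: bij_betw_def)
  moreover have "linear_on s s V r" "linear_on s s V v"
    by (simp_all add: linear_on_def r_def v_def \<Phi>.add \<Phi>.scale spl scale_def)
  moreover have "unified_map r v (unified_bracket br \<Omega> p q) =
      unified_bracket br \<Omega>' (unified_map r v p) (unified_map r v q)"
    if pq: "p \<in> G \<times> V" "q \<in> G \<times> V" for p q
  proof -
    have "unified_map r v (unified_bracket br \<Omega> p q) = split (\<Phi> (join (unified_bracket br \<Omega> p q)))"
      by (rule um[symmetric]) (rule unified_bracket_closed[OF m(1) pq])
    also have "\<dots> = split (bracket_of \<Omega>' (\<Phi> (join p)) (\<Phi> (join q)))"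
      by (simp only: unified_structure_join[OF pq, symmetric] hom)
    finally show ?thesis by (simp only: split_unified_structure[OF m(2)] um pq)
  qed
  ultimately have "unified_iso s G br V \<Omega> \<Omega>' r v"
    using rv by (auto simp only: unified_iso_def Pi_iff)
  then show "(\<Omega>, \<Omega>') \<in> H2g_equiv s G br V"
    unfolding H2g_equiv_iff[OF vs lie V] using m by blast
qed

end

section \<open>One-dimensional complements and twisted derivations\<close>

locale flag_complement = lie_complement s G V br
  for s :: "'k::field \<Rightarrow> 'e::ab_group_add \<Rightarrow> 'e" and G V :: "'e set" and br :: "'e \<Rightarrow> 'e \<Rightarrow> 'e" +
  fixes x :: 'e
  assumes x_nonzero: "x \<noteq> 0" and span_x: "span {x} = V"
begin

definition coord :: "'e \<Rightarrow> 'k" where "coord u = representation {x} u x"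

lemma V_eq: "V = range (\<lambda>c. s c x)"
  using span_x span_singleton by simp

lemma x_in_V [simp]: "x \<in> V" and scale_x_in_V [simp]: "s c x \<in> V"
  using span_x span_base[of x "{x}"] by (auto simp: V_eq)

lemma independent_x: "independent {x}"
  using x_nonzero by simp

lemma coord_add [simp]: "u \<in> V \<Longrightarrow> w \<in> V \<Longrightarrow> coord (u + w) = coord u + coord w"
  and coord_scale [simp]: "u \<in> V \<Longrightarrow> coord (s c u) = c * coord u"
  and coord_x [simp]: "coord x = 1"
  using independent_x by (simp_all add: coord_def representation_add representation_scale
      representation_basis span_x)

lemma coord_diff [simp]: "u \<in> V \<Longrightarrow> w \<in> V \<Longrightarrow> coord (u - w) = coord u - coord w"
  using coord_add[of "u - w" w] by simp

lemma coord_0 [simp]: "coord 0 = 0"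
  by (simp add: coord_def representation_zero)

lemma scale_coord [simp]: "u \<in> V \<Longrightarrow> s (coord u) x = u"
  by (auto simp: V_eq coord_scale[OF x_in_V])

text \<open>
  The Leibniz rule is stated with every \<open>D\<close> in the second argument of the bracket.  This makes it a
  rewrite rule with a normal form in which the terms of a Jacobi sum cancel.
\<close>

lemma TwDer_simps:
  assumes tw: "(l, D) \<in> TwDer s G br"
  shows "g \<in> G \<Longrightarrow> D g \<in> G"
    and "g \<in> G \<Longrightarrow> h \<in> G \<Longrightarrow> D (g + h) = D g + D h"
    and "g \<in> G \<Longrightarrow> h \<in> G \<Longrightarrow> D (g - h) = D g - D h"
    and "g \<in> G \<Longrightarrow> D (s c g) = s c (D g)"
    and "g \<in> G \<Longrightarrow> h \<in> G \<Longrightarrow> l (g + h) = l g + l h"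
    and "g \<in> G \<Longrightarrow> h \<in> G \<Longrightarrow> l (g - h) = l g - l h"
    and "g \<in> G \<Longrightarrow> l (s c g) = c * l g"
    and "g \<in> G \<Longrightarrow> h \<in> G \<Longrightarrow> l (br g h) = 0"
    and "g \<in> G \<Longrightarrow> h \<in> G \<Longrightarrow>
      D (br g h) = br g (D h) - br h (D g) + s (l g) (D h) - s (l h) (D g)"
proof -
  show D: "D g \<in> G" if "g \<in> G" for g
    using tw that by (auto simp: TwDer_def)
  show D_add: "D (g + h) = D g + D h" and l_add: "l (g + h) = l g + l h"
    if "g \<in> G" "h \<in> G" for g h
    using tw that by (simp_all add: TwDer_def linear_on_def)
  show "D (g - h) = D g - D h" "l (g - h) = l g - l h" if "g \<in> G" "h \<in> G"
    using D_add[of "g - h" h] l_add[of "g - h" h] that by simp_all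
  show "D (br g h) = br g (D h) - br h (D g) + s (l g) (D h) - s (l h) (D g)"
    if "g \<in> G" "h \<in> G"
    using tw that D br_anti[of "D g" h] by (simp add: TwDer_def)
  show "D (s c g) = s c (D g)" "l (s c g) = c * l g" if "g \<in> G"
    using tw that by (simp_all add: TwDer_def linear_on_def)
  show "l (br g h) = 0" if "g \<in> G" "h \<in> G"
    using tw that by (simp add: TwDer_def)
qed

abbreviation "Om \<equiv> Omega s G V x"

lemma Omega_eq:
  "Om (l, D) = (\<lambda>u\<in>V. \<lambda>g\<in>G. s (coord u) (s (l g) x), \<lambda>u\<in>V. \<lambda>g\<in>G. s (coord u) (D g),
     \<lambda>u\<in>V. \<lambda>w\<in>V. 0, \<lambda>u\<in>V. \<lambda>w\<in>V. 0)"
  by (simp add: Omega_def coord_def)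

lemma Omega_bracket:
  assumes "g \<in> G" "h \<in> G" "u \<in> V" "w \<in> V"
  shows "unified_bracket br (Om (l, D)) (g, u) (h, w) =
    (br g h + s (coord u) (D h) - s (coord w) (D g), s (coord u * l h - coord w * l g) x)"
  using assms by (simp add: Omega_eq scale_left_diff_distrib)

text \<open>
  In the Jacobi sum the terms of the \<open>G\<close>-component cancel by the Leibniz rule of \<open>D\<close>.  In the
  \<open>V\<close>-component the terms with \<open>l (br g h)\<close> vanish by hypothesis, and those with \<open>l (D g)\<close> and
  \<open>l g * l h\<close> cancel cyclically.
\<close>

lemma Omega_mem:
  assumes tw: "(l, D) \<in> TwDer s G br"
  shows "Om (l, D) \<in> lie_ext_structures s G br V"
proof -
  interpret vector_space_prod s s ..
  note tws = TwDer_simps[OF tw]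
  have [simp]: "D g \<in> G" if "g \<in> G" for g using tws(1) that by blast
  have "Om (l, D) \<in> extending_data s G V"
    unfolding Omega_eq extending_data_def
    by (auto simp: bilinear_on_def linear_on_def tws scale_left_distrib scale_right_distrib ring_distribs mult_ac)
  moreover have "lie_algebra_on scale (G \<times> V) (unified_bracket br (Om (l, D)))"
    unfolding lie_algebra_on_def
  proof (intro conjI)
    show "p.subspace (G \<times> V)" by (rule subspace_Times[OF G V])
    show "unified_bracket br (Om (l, D)) \<in> G \<times> V \<rightarrow> G \<times> V \<rightarrow> G \<times> V"
      by (clarsimp simp: Omega_bracket simp del: unified_bracket.simps)
    show "bilinear_on scale scale scale (G \<times> V) (G \<times> V) (unified_bracket br (Om (l, D)))"
      unfolding bilinear_on_def linear_on_def
      by (clarsimp simp: Omega_bracket scale_prod br_bilinear tws simp del: unified_bracket.simps)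
        (simp add: algebra_simps scale_left_distrib scale_right_distrib scale_left_diff_distrib scale_right_diff_distrib)
    show "\<forall>p\<in>G \<times> V. unified_bracket br (Om (l, D)) p p = 0"
      by (clarsimp simp: Omega_bracket br_alt zero_prod_def simp del: unified_bracket.simps)
    have "unified_bracket br (Om (l, D)) (g, u) (unified_bracket br (Om (l, D)) (h, v) (k, w)) +
        unified_bracket br (Om (l, D)) (h, v) (unified_bracket br (Om (l, D)) (k, w) (g, u)) +
        unified_bracket br (Om (l, D)) (k, w) (unified_bracket br (Om (l, D)) (g, u) (h, v)) = 0"
      if m: "g \<in> G" "h \<in> G" "k \<in> G" "u \<in> V" "v \<in> V" "w \<in> V" for g h k u v w
    proof -
      have jac: "br g (br h k) = - br h (br k g) - br k (br g h)"
        using br_jacobi[OF m(1-3)] by (simp add: eq_neg_iff_add_eq_0 algebra_simps)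
      show ?thesis using m
        by (simp add: jac Omega_bracket br_bilinear br_diff tws zero_prod_def algebra_simps
           scale_left_distrib scale_right_distrib scale_left_diff_distrib scale_right_diff_distrib
           del: unified_bracket.simps)
    qed
    then show "\<forall>p\<in>G \<times> V. \<forall>q\<in>G \<times> V. \<forall>r\<in>G \<times> V.
        unified_bracket br (Om (l, D)) p (unified_bracket br (Om (l, D)) q r) +
        unified_bracket br (Om (l, D)) q (unified_bracket br (Om (l, D)) r p) +
        unified_bracket br (Om (l, D)) r (unified_bracket br (Om (l, D)) p q) = 0"
      by blast
  qed
  ultimately show ?thesis by (simp add: lie_ext_structures_def)
qed

text \<open>
  The reason why nothing else exists over a line: \<open>f\<close> and \<open>{-,-}\<close> are alternating, hence zero, and
  the Jacobi identity for \<open>(0, x)\<close>, \<open>(g, 0)\<close>, \<open>(h, 0)\<close> forces the remaining pair \<open>(l, D)\<close> to be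
  a twisted derivation.
\<close>

lemma Omega_surj:
  assumes "\<Omega> \<in> lie_ext_structures s G br V"
  shows "\<exists>p\<in>TwDer s G br. Om p = \<Omega>"
proof -
  obtain ra la f cu where \<Omega>: "\<Omega> = (ra, la, f, cu)" by (cases \<Omega>)
  have ext: "(ra, la, f, cu) \<in> extending_data s G V"
    and lieU: "lie_algebra_on (module_prod.scale s s) (G \<times> V) (unified_bracket br \<Omega>)"
    using assms by (simp_all add: \<Omega> lie_ext_structures_def)
  have cl [simp]: "u \<in> V \<Longrightarrow> g \<in> G \<Longrightarrow> ra u g \<in> V" "u \<in> V \<Longrightarrow> g \<in> G \<Longrightarrow> la u g \<in> G" for u g
    using ext by (auto simp: extending_data_def)
  have right: "ra x (g + h) = ra x g + ra x h" "ra x (s c g) = s c (ra x g)"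
    "la x (g + h) = la x g + la x h" "la x (s c g) = s c (la x g)" if "g \<in> G" "h \<in> G" for g h c
    using ext that by (simp_all add: extending_data_def bilinear_on_def linear_on_def)
  have left: "ra (s c x) g = s c (ra x g)" "la (s c x) g = s c (la x g)" if "g \<in> G" for g c
    using ext that by (simp_all add: extending_data_def bilinear_on_def linear_on_def)
  have ff: "f (s a x) (s b x) = s a (s b (f x x))" "cu (s a x) (s b x) = s a (s b (cu x x))" for a b
    using ext by (simp_all add: extending_data_def bilinear_on_def linear_on_def)
  have "unified_bracket br \<Omega> (0, x) (0, x) = 0"
    using lieU by (simp add: lie_algebra_on_def)
  then have fx: "f x x = 0" "cu x x = 0"
    using ext by (simp_all add: \<Omega> zero_prod_def br_zero ext_datum_zero)
  define l where "l = (\<lambda>g\<in>G. coord (ra x g))"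
  define D where "D = (\<lambda>g\<in>G. la x g)"
  have ra: "ra x g = s (l g) x" and la: "la x g = D g" if "g \<in> G" for g
    using that by (simp_all add: l_def D_def)
  have D [simp]: "D g \<in> G" if "g \<in> G" for g using that by (simp add: D_def)
  have zero: "ra 0 g = 0" "la 0 g = 0" if "g \<in> G" for g
    using ext_datum_zero[OF ext] that by simp_all
  have zero': "f 0 u = 0" "f u 0 = 0" "cu 0 u = 0" "cu u 0 = 0" "la u 0 = 0" "ra u 0 = 0" if "u \<in> V" for u
    using ext_datum_zero[OF ext] that by simp_all
  have compat: "l (br g h) = 0 \<and>
      D (br g h) = br (D g) h + br g (D h) + s (l g) (D h) - s (l h) (D g)"
    if m: "g \<in> G" "h \<in> G" for g h
  proof -
    let ?U = "unified_bracket br \<Omega>"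
    have gh: "?U (g, 0) (h, 0) = (br g h, 0)" using ext m by (simp add: \<Omega> unified_bracket_G del: unified_bracket.simps)
    have xg: "?U (0, x) (g, u) = (D g + f x u, cu x u + s (l g) x)" if "g \<in> G" "u \<in> V" for g u
      using that by (simp add: \<Omega> br_zero zero' ra la)
    have gx: "?U (g, 0) (k, s c x) = (br g k - s c (D g), - s (c * l g) x)" if "g \<in> G" "k \<in> G" for g c k
      using that by (simp add: \<Omega> zero zero' left ra la)
    have "?U (0, x) (?U (g, 0) (h, 0)) + ?U (g, 0) (?U (h, 0) (0, x)) + ?U (h, 0) (?U (0, x) (g, 0)) = 0"
      using lieU m by (simp add: lie_algebra_on_def)
    moreover have "?U (0, x) (?U (g, 0) (h, 0)) = (D (br g h), s (l (br g h)) x)"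
      using m by (simp only: gh) (simp add: xg zero' del: unified_bracket.simps)
    moreover have "?U (h, 0) (0, x) = (- D h, s (- l h) x)"
      using gx[of h 0 1] m by (simp add: br_zero del: unified_bracket.simps)
    moreover have "?U (g, 0) (- D h, s (- l h) x) = (br g (- D h) + s (l h) (D g), s (l h * l g) x)"
      using gx[of g "- D h" "- l h"] m by (simp del: unified_bracket.simps)
    moreover have "?U (0, x) (g, 0) = (D g, s (l g) x)"
      using m by (simp add: xg zero' del: unified_bracket.simps)
    moreover have "?U (h, 0) (D g, s (l g) x) = (br h (D g) - s (l g) (D h), - s (l g * l h) x)"
      using gx[of h "D g" "l g"] m by (simp del: unified_bracket.simps)
    moreover have "br g (- D h) = - br g (D h)"
      using br_bilinear(4)[of "D h" g "-1"] m by simp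
    moreover have "br (D g) h = - br h (D g)" using m by (intro br_anti) simp_all
    ultimately show ?thesis by (simp add: zero_prod_def algebra_simps x_nonzero)
  qed
  have "(l, D) \<in> TwDer s G br"
    using compat by (auto simp: TwDer_def linear_on_def D_def l_def right)
  moreover have "Om (l, D) = \<Omega>"
    unfolding \<Omega> Omega_eq
  proof (rule extending_data_eqI[OF _ ext])
    show "(\<lambda>u\<in>V. \<lambda>g\<in>G. s (coord u) (s (l g) x), \<lambda>u\<in>V. \<lambda>g\<in>G. s (coord u) (D g),
     \<lambda>u\<in>V. \<lambda>w\<in>V. 0, \<lambda>u\<in>V. \<lambda>w\<in>V. 0) \<in> extending_data s G V"
      using Omega_mem[OF \<open>(l, D) \<in> TwDer s G br\<close>] by (simp add: lie_ext_structures_def Omega_eq)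
    fix u w g assume u: "u \<in> V"
    show "g \<in> G \<Longrightarrow> (\<lambda>u\<in>V. \<lambda>g\<in>G. s (coord u) (D g)) u g = la u g"
      using u left(2)[of g "coord u"] by (simp add: la)
    show "g \<in> G \<Longrightarrow> (\<lambda>u\<in>V. \<lambda>g\<in>G. s (coord u) (s (l g) x)) u g = ra u g"
      using u left(1)[of g "coord u"] by (simp add: ra)
    show "w \<in> V \<Longrightarrow> (\<lambda>u\<in>V. \<lambda>w\<in>V. 0) u w = f u w"
      using u ff(1)[of "coord u" "coord w"] by (simp add: fx)
    show "w \<in> V \<Longrightarrow> (\<lambda>u\<in>V. \<lambda>w\<in>V. 0) u w = cu u w"
      using u ff(2)[of "coord u" "coord w"] by (simp add: fx)
  qed
  ultimately show ?thesis by blast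
qed

lemma Omega_image: "Om ` TwDer s G br = lie_ext_structures s G br V"
proof
  show "Om ` TwDer s G br \<subseteq> lie_ext_structures s G br V" by (auto simp: Omega_mem)
  show "lie_ext_structures s G br V \<subseteq> Om ` TwDer s G br" using Omega_surj by (metis imageI subsetI)
qed

lemma coord_image_x_nonzero:
  assumes "bij_betw v V V" "linear_on s s V v"
  shows "coord (v x) \<noteq> 0"
proof
  assume "coord (v x) = 0"
  moreover have "v x \<in> V" using assms(1) by (auto simp: bij_betw_def)
  ultimately have "v x = 0" using scale_coord[of "v x"] by simp
  moreover have "v 0 = 0" using assms(2) linear_on_zero[of s s V v] by simp
  moreover have "inj_on v V" using assms(1) by (simp add: bij_betw_def)
  ultimately show False using x_nonzero inj_onD[of v V x 0] by simp
qed

text \<open>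
  On multiples of \<open>x\<close> the conditions on \<open>f\<close> and \<open>{-,-}\<close> in an isomorphism hold automatically, again
  because they are alternating.  The conditions on the two actions are linear in the vector
  of \<open>V\<close>, so that they need to be tested at \<open>x\<close> only.
\<close>

lemma Omega_iso_iff:
  assumes tw: "(l, D) \<in> TwDer s G br" "(l', D') \<in> TwDer s G br"
  shows "unified_iso s G br V (Om (l, D)) (Om (l', D')) r v \<longleftrightarrow>
    r \<in> V \<rightarrow> G \<and> linear_on s s V r \<and> bij_betw v V V \<and> linear_on s s V v \<and>
    (\<forall>g\<in>G. l g = l' g \<and> D g = s (coord (v x)) (D' g) + br (r x) g - s (l g) (r x))"
proof (cases "r \<in> V \<rightarrow> G \<and> linear_on s s V r \<and> bij_betw v V V \<and> linear_on s s V v")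
  case False
  then show ?thesis by (auto simp: unified_iso_def)
next
  case True
  have rx [simp]: "r x \<in> G" and vx: "v x \<in> V" using True by (auto simp: bij_betw_def)
  have r: "r (s c x) = s c (r x)" and v: "v (s c x) = s c (v x)" for c
    using True by (simp_all add: linear_on_def)
  define q where "q = coord (v x)"
  have vq: "v x = s q x" using vx by (simp add: q_def)
  have q: "q \<noteq> 0" using True coord_image_x_nonzero by (simp add: q_def)
  note tws = TwDer_simps[OF tw(1)] TwDer_simps[OF tw(2)]
  have anti: "br g (r x) = - br (r x) g" if "g \<in> G" for g using that by (intro br_anti) simp_all
  define ra la ra' la' f where
    defs: "ra = (\<lambda>u\<in>V. \<lambda>g\<in>G. s (coord u) (s (l g) x))" "la = (\<lambda>u\<in>V. \<lambda>g\<in>G. s (coord u) (D g))"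
      "ra' = (\<lambda>u\<in>V. \<lambda>g\<in>G. s (coord u) (s (l' g) x))" "la' = (\<lambda>u\<in>V. \<lambda>g\<in>G. s (coord u) (D' g))"
      "f = (\<lambda>u\<in>V. \<lambda>w\<in>V. 0 :: 'e)"
  have Om: "Om (l, D) = (ra, la, f, f)" "Om (l', D') = (ra', la', f, f)"
    by (simp_all add: Omega_eq defs)
  note mem = Omega_mem[OF tw(1), unfolded Om(1)] Omega_mem[OF tw(2), unfolded Om(2)]
  have r0: "r 0 = 0" and v0: "v 0 = 0" using r[of 0] v[of 0] by simp_all
  have f_rule: "f (v u) (v w) = f u w + r (f u w) + br (r u) (r w)
         - r (ra u (r w)) - la u (r w) + r (ra w (r u)) + la w (r u)"
    and cu_rule: "f (v u) (v w) = v (f u w) - v (ra u (r w)) + v (ra w (r u))"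
    if "u \<in> V" "w \<in> V" for u w
  proof -
    obtain a b where ab: "u = s a x" "w = s b x" using \<open>u \<in> V\<close> \<open>w \<in> V\<close> by (auto simp: V_eq)
    show "f (v u) (v w) = f u w + r (f u w) + br (r u) (r w)
         - r (ra u (r w)) - la u (r w) + r (ra w (r u)) + la w (r u)"
      "f (v u) (v w) = v (f u w) - v (ra u (r w)) + v (ra w (r u))"
      by (simp_all add: ab defs r v vx tws br_bilinear br_alt r0 v0 mult_ac)
  qed
  have "unified_iso s G br V (Om (l, D)) (Om (l', D')) r v \<longleftrightarrow>
    (\<forall>g\<in>G. \<forall>u\<in>V. ra' (v u) g = v (ra u g) \<and> la' (v u) g = r (ra u g) + la u g + br g (r u))"
    unfolding Om unified_iso_iff[OF vs lie V mem] using True f_rule cu_rule V_closed(1) by blast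
  also have "\<dots> \<longleftrightarrow> (\<forall>g\<in>G. l g = l' g \<and> s q (D' g) = s (l g) (r x) + D g + br g (r x))"
  proof (intro iffI ballI conjI)
    fix g assume g: "g \<in> G" and "\<forall>g\<in>G. \<forall>u\<in>V. ra' (v u) g = v (ra u g) \<and> la' (v u) g = r (ra u g) + la u g + br g (r u)"
    then have "ra' (v x) g = v (ra x g)" "la' (v x) g = r (ra x g) + la x g + br g (r x)" by simp_all
    then show "l g = l' g" "s q (D' g) = s (l g) (r x) + D g + br g (r x)"
      using g q x_nonzero by (simp_all add: defs r v vq)
  next
    fix g u assume g: "g \<in> G" and "u \<in> V"
      and E: "\<forall>g\<in>G. l g = l' g \<and> s q (D' g) = s (l g) (r x) + D g + br g (r x)"
    then obtain a where a: "u = s a x" by (auto simp: V_eq)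
    have E1: "l g = l' g" and E2: "s q (D' g) = s (l g) (r x) + D g + br g (r x)" using E g by simp_all
    show "ra' (v u) g = v (ra u g)"
      using g by (simp add: defs r v vq a E1[symmetric] mult_ac)
    have "la' (v u) g = s a (s q (D' g))" using g by (simp add: defs v vq a)
    also have "\<dots> = r (ra u g) + la u g + br g (r u)"
      unfolding E2 using g by (simp add: defs r a br_bilinear scale_right_distrib)
    finally show "la' (v u) g = r (ra u g) + la u g + br g (r u)" .
  qed
  also have "\<dots> \<longleftrightarrow> (\<forall>g\<in>G. l g = l' g \<and> D g = s q (D' g) + br (r x) g - s (l g) (r x))"
    using anti by (auto simp: algebra_simps)
  finally show ?thesis using True by (simp add: q_def)
qed

lemma linear_on_coord_scale:
  "linear_on s s V (\<lambda>u. s (coord u) e)"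
  by (simp add: linear_on_def scale_left_distrib)

text \<open>
  The pair \<open>(g0, q)\<close> corresponds to the isomorphism with \<open>r x = g0\<close> and \<open>v\<close> the scaling by \<open>q\<close>.
\<close>

lemma TwDer_equiv_iff:
  assumes m: "p \<in> TwDer s G br" "p' \<in> TwDer s G br"
  shows "(p, p') \<in> TwDer_equiv s G br \<longleftrightarrow> (Om p, Om p') \<in> H2g_equiv s G br V"
proof -
  obtain l D l' D' where p: "p = (l, D)" "p' = (l', D')" by (cases p, cases p')
  note tw = m[unfolded p]
  have Om_mem: "Om (l, D) \<in> lie_ext_structures s G br V" "Om (l', D') \<in> lie_ext_structures s G br V"
    using tw by (simp_all only: Omega_mem)
  show ?thesis
    unfolding p
  proof
    assume "((l, D), (l', D')) \<in> TwDer_equiv s G br"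
    then obtain g0 q where l: "l = l'" and g0: "g0 \<in> G" and q: "q \<noteq> 0"
      and D: "\<And>h. h \<in> G \<Longrightarrow> D h = s q (D' h) + br g0 h - s (l h) g0"
      unfolding TwDer_equiv_def by blast
    have "bij_betw (s q) V V"
      by (rule bij_betw_byWitness[where f' = "s (inverse q)"]) (use q in auto)
    moreover have "linear_on s s V (s q)"
      by (simp add: linear_on_def scale_right_distrib mult.commute)
    ultimately have "unified_iso s G br V (Om (l, D)) (Om (l', D')) (\<lambda>u. s (coord u) g0) (s q)"
      unfolding Omega_iso_iff[OF tw] using l g0 D by (simp add: linear_on_coord_scale)
    then show "(Om (l, D), Om (l', D')) \<in> H2g_equiv s G br V"
      unfolding H2g_equiv_iff[OF vs lie V] using Om_mem by blast
  next
    assume "(Om (l, D), Om (l', D')) \<in> H2g_equiv s G br V"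
    then obtain r v where "unified_iso s G br V (Om (l, D)) (Om (l', D')) r v"
      unfolding H2g_equiv_iff[OF vs lie V] by blast
    note iso = this[unfolded Omega_iso_iff[OF tw]]
    have "l = l'" using iso tw by (intro PiE_ext[of l G "\<lambda>_. UNIV" l']) (simp_all add: TwDer_def)
    moreover have "coord (v x) \<noteq> 0" using iso coord_image_x_nonzero by blast
    moreover have "r x \<in> G" using iso by auto
    ultimately show "((l, D), (l', D')) \<in> TwDer_equiv s G br"
      unfolding TwDer_equiv_def using iso tw by (auto intro!: bexI[of _ "r x"] exI[of _ "coord (v x)"])
  qed
qed

lemma TwDer_approx_iff:
  assumes m: "p \<in> TwDer s G br" "p' \<in> TwDer s G br"
  shows "(p, p') \<in> TwDer_approx s G br \<longleftrightarrow> (Om p, Om p') \<in> H2_equiv s G br V"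
proof -
  obtain l D l' D' where p: "p = (l, D)" "p' = (l', D')" by (cases p, cases p')
  note tw = m[unfolded p]
  have Om_mem: "Om (l, D) \<in> lie_ext_structures s G br V" "Om (l', D') \<in> lie_ext_structures s G br V"
    using tw by (simp_all only: Omega_mem)
  have id: "bij_betw (\<lambda>u. u) V V" "linear_on s s V (\<lambda>u. u)"
    by (auto simp: bij_betw_def linear_on_def)
  have eq: "D h - D' h = br g0 h - s (l h) g0 \<longleftrightarrow> D h = D' h + br g0 h - s (l h) g0" for h g0
    by (auto simp: algebra_simps)
  show ?thesis
    unfolding p
  proof
    assume "((l, D), (l', D')) \<in> TwDer_approx s G br"
    then have l: "l = l'" and "\<exists>g0\<in>G. \<forall>h\<in>G. D h - D' h = br g0 h - s (l h) g0"
      unfolding TwDer_approx_def by blast+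
    then obtain g0 where g0: "g0 \<in> G" and D: "\<And>h. h \<in> G \<Longrightarrow> D h = D' h + br g0 h - s (l h) g0"
      unfolding eq by blast
    have "unified_iso s G br V (Om (l, D)) (Om (l', D')) (\<lambda>u. s (coord u) g0) (\<lambda>u. u)"
      unfolding Omega_iso_iff[OF tw] using l g0 D by (simp add: linear_on_coord_scale id)
    then show "(Om (l, D), Om (l', D')) \<in> H2_equiv s G br V"
      unfolding H2_equiv_iff[OF vs lie V] using Om_mem by blast
  next
    assume "(Om (l, D), Om (l', D')) \<in> H2_equiv s G br V"
    then obtain r where "unified_iso s G br V (Om (l, D)) (Om (l', D')) r (\<lambda>u. u)"
      unfolding H2_equiv_iff[OF vs lie V] by blast
    note iso = this[unfolded Omega_iso_iff[OF tw]]
    have "l = l'" using iso tw by (intro PiE_ext[of l G "\<lambda>_. UNIV" l']) (simp_all add: TwDer_def)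
    moreover have "r x \<in> G" "\<forall>g\<in>G. D g = D' g + br (r x) g - s (l g) (r x)" using iso by auto
    then have "\<exists>g0\<in>G. \<forall>h\<in>G. D h - D' h = br g0 h - s (l h) g0"
      unfolding eq by blast
    ultimately show "((l, D), (l', D')) \<in> TwDer_approx s G br"
      using tw by (auto simp: TwDer_approx_def)
  qed
qed

end

theorem theorem4p7:
  fixes s :: "'k::field \<Rightarrow> 'e::ab_group_add \<Rightarrow> 'e"
    and G V :: "'e set" and br :: "'e \<Rightarrow> 'e \<Rightarrow> 'e" and x :: 'e
  assumes "vector_space s"
    and "lie_algebra_on s G br" and "G \<noteq> {0}"
    and "complement_of s G V" and "vector_space.dim s V = 1"
    and "\<not> module.dependent s {x}" and "module.span s {x} = V"
  shows
    "equiv (TwDer s G br) (TwDer_equiv s G br) \<and>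

     (\<exists>\<Phi>. bij_betw \<Phi> (Extd s G br) (H2g s G br V)) \<and>
     (\<exists>\<Psi>. bij_betw \<Psi> (H2g s G br V) (TwDer s G br // TwDer_equiv s G br)) \<and>
     (\<exists>F. bij_betw F (TwDer s G br // TwDer_equiv s G br) (Extd s G br) \<and>
        (\<forall>p\<in>TwDer s G br. F (TwDer_equiv s G br `` {p}) =
           Extd_equiv s G br `` {unified_structure G br V (Omega s G V x p)})) \<and>

     equiv (TwDer s G br) (TwDer_approx s G br) \<and>
     (\<exists>F. bij_betw F (TwDer s G br // TwDer_approx s G br) (H2 s G br V) \<and>
        (\<forall>p\<in>TwDer s G br. F (TwDer_approx s G br `` {p}) =
           H2_equiv s G br V `` {Omega s G V x p}))"
proof -
  interpret vector_space s by fact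
  interpret flag_complement s G V br x
    using assms by unfold_locales simp_all
  let ?T = "TwDer s G br" and ?L = "lie_ext_structures s G br V"
  let ?E = "lie_structures_extending s G br"
  note eqE = Extd_equiv_equiv[OF vs, of G br]
    and eqHg = H2g_equiv_equiv[OF vs lie V] and eqH = H2_equiv_equiv[OF vs lie V]
  have Om: "Om ` ?T = ?L" and struct: "bracket_of ` ?L = ?E"
    by (fact Omega_image, fact unified_structure_image)
  then have Om_mem: "Om \<in> ?T \<rightarrow> ?L" by auto
  have "TwDer_equiv s G br \<subseteq> ?T \<times> ?T" "TwDer_approx s G br \<subseteq> ?T \<times> ?T"
    by (auto simp: TwDer_equiv_def TwDer_approx_def)
  then have eqT: "equiv ?T (TwDer_equiv s G br)" and eqA: "equiv ?T (TwDer_approx s G br)"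
    using equiv_pullback[OF eqHg Om_mem _ TwDer_equiv_iff]
      equiv_pullback[OF eqH Om_mem _ TwDer_approx_iff] by blast+
  have TH: "\<exists>F. bij_betw F (?T // TwDer_equiv s G br) (H2g s G br V)"
    unfolding H2g_def using bij_betw_quotients[OF eqT eqHg Om TwDer_equiv_iff] by blast
  have HE: "\<exists>F. bij_betw F (H2g s G br V) (Extd s G br)"
    unfolding H2g_def Extd_def using bij_betw_quotients[OF eqHg eqE struct Extd_equiv_iff[symmetric]] by blast
  have TE: "\<exists>F. bij_betw F (?T // TwDer_equiv s G br) (Extd s G br) \<and>
      (\<forall>p\<in>?T. F (TwDer_equiv s G br `` {p}) = Extd_equiv s G br `` {bracket_of (Om p)})"
    unfolding Extd_def
  proof (rule bij_betw_quotients[OF eqT eqE])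
    show "(\<lambda>p. bracket_of (Om p)) ` ?T = ?E" using Om struct by (simp flip: image_image)
    fix p q assume "p \<in> ?T" "q \<in> ?T"
    then show "(p, q) \<in> TwDer_equiv s G br \<longleftrightarrow> (bracket_of (Om p), bracket_of (Om q)) \<in> Extd_equiv s G br"
      using Om_mem by (simp add: TwDer_equiv_iff Extd_equiv_iff Pi_iff)
  qed
  have TA: "\<exists>F. bij_betw F (?T // TwDer_approx s G br) (H2 s G br V) \<and>
      (\<forall>p\<in>?T. F (TwDer_approx s G br `` {p}) = H2_equiv s G br V `` {Om p})"
    unfolding H2_def by (rule bij_betw_quotients[OF eqA eqH Om TwDer_approx_iff])
  have EH: "\<exists>\<Phi>. bij_betw \<Phi> (Extd s G br) (H2g s G br V)"
    using HE by (elim exE) (rule bij_betw_inv)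
  have HT: "\<exists>\<Psi>. bij_betw \<Psi> (H2g s G br V) (?T // TwDer_equiv s G br)"
    using TH by (elim exE) (rule bij_betw_inv)
  show ?thesis
    by (intro conjI eqT EH HT TE eqA TA)
qed

end
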